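(* Let $N\geq 5$ and let $(M,g)$ be an $N$-dimensional Riemannian model with pole $o$ and metric $ds^2=dr^2+\psi^2(r)\,d\omega^2$, where $\psi$ is a $C^\infty$ nonnegative function on $[0,+\infty)$, positive on $(0,+\infty)$, with $\psi'(0)=1$, $\psi^{(2k)}(0)=0$ for all $k\geq0$, and such that for all $r>0$: $K_{\pi,r}^{rad}\leq -1$ and $K_{\pi,r}^{rad}\geq H_{\pi,r}^{tan}$. Then for all $u\in C_c^\infty(M)$, $$\int_M(\Delta_g u)^2dv_g-\Big(\frac{N-1}{2}\Big)^4\int_M u^2dv_g\geq\frac{(N-4)^2}{16}\int_M\frac{u^2}{r^4}dv_g+\frac{(N-1)^2}{16}\int_M\frac{u^2}{r^2}dv_g.$$
   Context: $d\omega^2$ is the standard metric on $\mathbb{S}^{N-1}$, $r$ the geodesic distance from $o$, $dv_g$ the Riemannian volume, $\Delta_g$ the Laplace–Beltrami operator of $g$, $K_{\pi,r}^{rad}=-\frac{\psi''}{\psi}$, $H_{\pi,r}^{tan}=-\frac{(\psi')^2-1}{\psi^2}$. *)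

theory Defs
  imports "HOL-Analysis.Analysis"
begin

text \<open>The model manifold is realised in global normal coordinates at the pole o,
  i.e. M = R^N (index type 'n, N = CARD('n)), o = 0, r = norm x.  In these
  coordinates ds^2 = dr^2 + psi(r)^2 d omega^2 reads
  g_ij = (psi r / r)^2 (delta_ij - x_i x_j / r^2) + x_i x_j / r^2.\<close>

definition pdir :: "'n::finite \<Rightarrow> (real^'n \<Rightarrow> real) \<Rightarrow> real^'n \<Rightarrow> real" where
  "pdir i f x = deriv (\<lambda>t. f (x + t *\<^sub>R axis i 1)) 0"

coinductive smooth_fn :: "(real^'n::finite \<Rightarrow> real) \<Rightarrow> bool" where
  "f differentiable_on UNIV \<Longrightarrow> (\<forall>i. smooth_fn (pdir i f)) \<Longrightarrow> smooth_fn f"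

definition ginv :: "(real \<Rightarrow> real) \<Rightarrow> 'n::finite \<Rightarrow> 'n \<Rightarrow> real^'n \<Rightarrow> real" where
  "ginv psi i j y = (norm y / psi (norm y))^2 * ((if i = j then 1 else 0) - y$i * y$j / (norm y)^2)
                    + y$i * y$j / (norm y)^2"

text \<open>sqrt(det g): density of dv_g w.r.t. Lebesgue measure.\<close>
definition voldens :: "(real \<Rightarrow> real) \<Rightarrow> real^'n::finite \<Rightarrow> real" where
  "voldens psi y = (psi (norm y) / norm y) ^ (CARD('n) - 1)"

definition lap_g :: "(real \<Rightarrow> real) \<Rightarrow> (real^'n::finite \<Rightarrow> real) \<Rightarrow> real^'n \<Rightarrow> real" where
  "lap_g psi u x = (1 / voldens psi x) *
     (\<Sum>i\<in>UNIV. pdir i (\<lambda>y. voldens psi y * (\<Sum>j\<in>UNIV. ginv psi i j y * pdir j u y)) x)"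

end

(* Write n = N - 1, h = psi'/psi, lam = n^2/4 and a(r) = lam + 1/(4 r^2). Expanding the square
   (Delta_g u + a u)^2 >= 0 and integrating by parts bounds the integral of (Delta_g u)^2 from
   below by a first-order energy with weight 2a; of its gradient only the radial part u_r is kept. Completing
   the squares (u_r + p u)^2 with p = n h/2 - 1/(2r) for the part lam of the weight and
   p = n h/2 - 3/(2r) for the part 1/(4 r^2) leaves a potential which is large enough because
   psi'' >= psi forces h >= 1 and h >= 1/r. All this is one pointwise inequality up to the divergence
   of a vector field of size O(r^-3) whose derivative is O(r^-4); since r^-4 is locally integrable
   for N >= 5, that divergence integrates to zero despite the singularity at the pole, and crude
   power bounds at the pole suffice for every integrability claim. *)
theory Submission
  imports Defs
begin

text \<open>The constant lam is the bottom of the spectrum of the negative Laplacian in the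
  hyperbolic case psi = sinh, and 1/(4 r^2) is its Hardy correction, so a(r) is the potential of the
  first-order Poincare-Hardy inequality. Writing u = psi^(-n/2) v removes the first-order term of
  the radial Laplacian; this is the origin of n h/2 in both choices of p. The rest of p comes from
  the half-line Hardy inequalities for the weights 1 and r^-2, whose extremal profiles are r^(1/2)
  and r^(3/2): u_r + p u vanishes for u = psi^(-n/2) r^(1/2) and u = psi^(-n/2) r^(3/2)
  respectively. Once both p are fixed, equating the coefficients of u u_r leaves a single choice q
  for the radial part u^2 q of the vector field.

  The obstacle is analytic: in normal coordinates the coefficients involve x/|x| and negative powers
  of |x|, so no divergence theorem for smooth fields applies directly. Hence the calculus of
  singularity orders below, in which products add orders and derivatives cost one.\<close>

section \<open>Integrating partial derivatives\<close>

text \<open>Dyadic decomposition: for s/2 < |x| <= s the integrand is at most (2/s)^k, and replacing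
  each such shell by the full ball of radius s costs nothing essential. With s = R/2^j the resulting
  integrals form a geometric series of ratio 2^-(N-k), which converges because k < N.\<close>

lemma integrable_inverse_power_norm_cball:
  fixes R :: real
  assumes k: "k < DIM('a::euclidean_space)" and R: "R > 0"
  shows "integrable lborel (\<lambda>x::'a. indicator (cball 0 R) x / norm x ^ k)"
proof (rule integrableI_bounded)
  show "(\<lambda>x::'a. indicator (cball 0 R) x / norm x ^ k :: real) \<in> borel_measurable lborel"
    by (intro borel_measurable_divide borel_measurable_indicator borel_measurable_power
        borel_measurable_norm) auto
  define N where "N = DIM('a)"
  define w where "w = unit_ball_vol (real N)"
  define s where "s j = R * (1/2) ^ j" for j :: nat
  define c where "c = w * R ^ N * (2 / R) ^ k"
  have s_pos: "s j > 0" for j using R by (simp add: s_def)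
  have w0: "w \<ge> 0" by (simp add: w_def)
  have c0: "c \<ge> 0" using R w0 by (simp add: c_def)
  let ?f = "\<lambda>x::'a. ennreal (norm (indicator (cball 0 R) x / norm x ^ k :: real))"
  let ?g = "\<lambda>j (x::'a). ennreal ((2 / s j) ^ k) * indicator (cball 0 (s j)) x"
  have term_le: "a j \<le> suminf a" for a :: "nat \<Rightarrow> ennreal" and j
    using sum_le_suminf[of a "{j}"] by simp
  have le: "?f x \<le> (\<Sum>j. ?g j x)" if "x \<noteq> 0" for x
  proof (cases "norm x \<le> R")
    case False
    then show ?thesis by simp
  next
    case True
    have nx: "norm x > 0" using that by simp
    have lim: "s \<longlonglongrightarrow> 0"
      unfolding s_def by (rule LIMSEQ_realpow_zero[THEN tendsto_mult_right_zero]) auto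
    have "\<exists>j. s j < norm x"
      using order_tendstoD(2)[OF lim nx] eventually_sequentially by auto
    then have jl: "s (LEAST j. s j < norm x) < norm x" by (rule LeastI_ex)
    \<comment> \<open>Index of the largest dyadic radius below |x|. It is nonzero because
      \<open>s 0 = R\<close>, and its predecessor \<open>j\<close> labels the shell that contains
      x.\<close>
    define m where "m = (LEAST j. s j < norm x)"
    have "s 0 = R" by (simp add: s_def)
    then have "m \<noteq> 0" using jl True unfolding m_def[symmetric] by (metis not_less)
    then obtain j where j: "m = Suc j" using not0_implies_Suc by blast
    have "\<not> s j < norm x" using j not_less_Least[of j "\<lambda>j. s j < norm x"] by (auto simp: m_def)
    then have up: "norm x \<le> s j" by simp
    have "s j = 2 * s m" by (simp add: j s_def)
    then have "s j < 2 * norm x" using jl unfolding m_def[symmetric] by simp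
    then have "1 / norm x \<le> 2 / s j" using nx s_pos[of j] by (simp add: field_simps)
    then have "(1 / norm x) ^ k \<le> (2 / s j) ^ k" by (intro power_mono) auto
    then have "?f x \<le> ?g j x" using up True s_pos[of j] by (simp add: power_one_over ennreal_leI power_divide)
    also have "\<dots> \<le> (\<Sum>j. ?g j x)" by (rule term_le)
    finally show ?thesis .
  qed
  have "(\<integral>\<^sup>+x. ?f x \<partial>lborel) \<le> (\<integral>\<^sup>+x. (\<Sum>j. ?g j x) \<partial>lborel)"
    using le AE_lborel_singleton[of "0::'a"] by (intro nn_integral_mono_AE) auto
  also have "\<dots> = (\<Sum>j. \<integral>\<^sup>+x. ?g j x \<partial>lborel)"
    by (intro nn_integral_suminf borel_measurable_times_ennreal borel_measurable_indicator) auto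
  also have "(\<lambda>j. \<integral>\<^sup>+x. ?g j x \<partial>lborel) = (\<lambda>j. ennreal (c * ((1/2) ^ (N - k)) ^ j))"
  proof
    fix j
    have "(\<integral>\<^sup>+x. ?g j x \<partial>lborel) = ennreal ((2 / s j) ^ k) * emeasure lborel (cball (0::'a) (s j))"
      by (intro nn_integral_cmult_indicator) auto
    also have "\<dots> = ennreal ((2 / s j) ^ k * (w * s j ^ N))"
      using s_pos[of j] by (simp add: emeasure_cball w_def N_def ennreal_mult'')
    also have "(2 / s j) ^ k * (w * s j ^ N) = c * ((1/2) ^ (N - k)) ^ j"
    proof -
      have "(2 / s j) ^ k * (w * s j ^ N) = 2 ^ k * w * s j ^ (N - k)"
        using k s_pos[of j] by (simp add: power_divide power_diff N_def)
      also have "\<dots> = 2 ^ k * w * R ^ (N - k) * ((1/2) ^ (N - k)) ^ j"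
        by (simp add: s_def power_mult_distrib flip: power_mult) (simp add: mult.commute)
      also have "2 ^ k * w * R ^ (N - k) = c"
        using k R by (simp add: c_def power_diff N_def power_divide)
      finally show ?thesis .
    qed
    finally show "(\<integral>\<^sup>+x. ?g j x \<partial>lborel) = ennreal (c * ((1/2) ^ (N - k)) ^ j)" .
  qed
  also have "(\<Sum>j. ennreal (c * ((1/2) ^ (N - k)) ^ j)) < \<infinity>"
  proof -
    have "N - k \<noteq> 0" using k by (simp add: N_def)
    then have "summable (\<lambda>j. c * ((1/2::real) ^ (N - k)) ^ j)"
      by (intro summable_mult summable_geometric) (simp add: power_abs power_less_one_iff)
    then have "(\<Sum>j. ennreal (c * ((1/2) ^ (N - k)) ^ j)) = ennreal (\<Sum>j. c * ((1/2) ^ (N - k)) ^ j)"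
      using c0 by (intro suminf_ennreal2) auto
    then show ?thesis by (simp add: less_top[symmetric])
  qed
  finally show "(\<integral>\<^sup>+x. ?f x \<partial>lborel) < \<infinity>" .
qed

text \<open>A relation with a prescribed value, because \<open>pdir\<close> is built on
  \<open>deriv\<close>, which returns some value even where no derivative exists.\<close>

definition has_pd :: "(real^'n::finite \<Rightarrow> real) \<Rightarrow> 'n \<Rightarrow> real \<Rightarrow> real^'n \<Rightarrow> bool" where
  "has_pd f i d x \<longleftrightarrow> ((\<lambda>t. f (x + t *\<^sub>R axis i 1)) has_real_derivative d) (at 0)"

lemma has_pd_shift:
  assumes "has_pd f i d (x + t *\<^sub>R axis i 1)"
  shows "((\<lambda>s. f (x + s *\<^sub>R axis i 1)) has_real_derivative d) (at t)"
proof -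
  have "((\<lambda>s. f (x + t *\<^sub>R axis i 1 + (s - t) *\<^sub>R axis i 1)) has_real_derivative d * 1) (at t)"
    using assms unfolding has_pd_def
    by (intro DERIV_chain2[of "\<lambda>s. f (x + t *\<^sub>R axis i 1 + s *\<^sub>R axis i 1)" _ "\<lambda>s. s - t"])
       (auto intro!: derivative_eq_intros)
  moreover have "x + t *\<^sub>R axis i 1 + (s - t) *\<^sub>R axis i 1 = x + s *\<^sub>R axis i 1" for s
    by (simp add: scaleR_diff_left)
  ultimately show ?thesis by simp
qed

text \<open>Lebesgue measure is translation invariant, so all difference quotients integrate to 0.\<close>

lemma integral_partial_derivative_eq_0:
  fixes f :: "real^'n::finite \<Rightarrow> real"
  assumes f: "integrable lborel f"
    and deriv: "\<And>x. has_pd f i (g x) x"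
    and bound: "\<And>x. \<bar>g x\<bar> \<le> B"
    and zero: "\<And>x. norm x > R \<Longrightarrow> f x = 0"
  shows "g \<in> borel_measurable lborel" "integral\<^sup>L lborel g = 0"
proof -
  define e :: "real^'n" where "e = axis i 1"
  define t where "t m = 1 / real (Suc m)" for m
  have t0: "t m > 0" and t1: "t m \<le> 1" for m by (auto simp: t_def)
  have ne: "norm e = 1" by (simp add: e_def norm_axis_1)
  define Q where "Q m x = (f (x + t m *\<^sub>R e) - f x) / t m" for m x
  have fm: "f \<in> borel_measurable borel" using borel_measurable_integrable[OF f] by simp
  then have Qm: "Q m \<in> borel_measurable lborel" for m unfolding Q_def by measurable
  have tlim: "t \<longlonglongrightarrow> 0" unfolding t_def by (rule LIMSEQ_Suc[OF lim_1_over_n])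
  have lim: "(\<lambda>m. Q m x) \<longlonglongrightarrow> g x" for x
  proof -
    have "((\<lambda>h. (f (x + h *\<^sub>R e) - f x) / h) \<longlongrightarrow> g x) (at 0)"
      using deriv[of x] by (simp add: has_pd_def DERIV_def e_def)
    moreover have "filterlim t (at 0) sequentially"
      using tlim t0 by (auto simp: filterlim_at less_imp_neq[symmetric] intro!: always_eventually)
    ultimately show ?thesis unfolding Q_def
      using filterlim_compose[of "\<lambda>h. (f (x + h *\<^sub>R e) - f x) / h" "nhds (g x)" "at 0" t sequentially] by simp
  qed
  show gm: "g \<in> borel_measurable lborel"
    by (rule borel_measurable_LIMSEQ_real[OF lim Qm])
  \<comment> \<open>A dominating function independent of \<open>m\<close>: the mean value theorem
    bounds the quotient by \<open>B\<close>, and \<open>t m <= 1\<close> keeps all shifted supports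
    in the ball of radius R + 1.\<close>
  have Qb: "\<bar>Q m x\<bar> \<le> B * indicator (cball 0 (R + 1)) x" for m x
  proof (cases "norm x \<le> R + 1")
    case True
    obtain z where "f (x + t m *\<^sub>R e) - f (x + 0 *\<^sub>R e) = (t m - 0) * g (x + z *\<^sub>R e)"
      using MVT2[of 0 "t m" "\<lambda>s. f (x + s *\<^sub>R e)" "\<lambda>s. g (x + s *\<^sub>R e)"] t0[of m]
        has_pd_shift[OF deriv] unfolding e_def by blast
    then have "Q m x = g (x + z *\<^sub>R e)" using t0[of m] by (simp add: Q_def)
    then show ?thesis using True bound by simp
  next
    case False
    have "norm x - norm (t m *\<^sub>R e) \<le> norm (x + t m *\<^sub>R e)" by (rule norm_diff_ineq)
    then have "norm (x + t m *\<^sub>R e) > R" using False t0[of m] t1[of m] ne by simp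
    then show ?thesis using False zero by (simp add: Q_def)
  qed
  have "(\<lambda>m. integral\<^sup>L lborel (Q m)) \<longlonglongrightarrow> integral\<^sup>L lborel g"
  proof (rule integral_dominated_convergence[where w="\<lambda>x. B * indicator (cball 0 (R+1)) x"])
    show "integrable lborel (\<lambda>x. B * indicator (cball (0::real^'n) (R+1)) x)"
      by (intro integrable_mult_right integrable_real_indicator) (use emeasure_bounded_finite[OF bounded_cball] in auto)
  qed (use gm Qm lim Qb in auto)
  moreover have "integral\<^sup>L lborel (Q m) = 0" for m
  proof -
    have "integrable lborel (\<lambda>x. f (t m *\<^sub>R e + x))"
      using f integrable_distr_eq[of "(+) (t m *\<^sub>R e)" lborel borel f] fm
      by (simp add: lborel_distr_plus)
    moreover have "integral\<^sup>L lborel (\<lambda>x. f (t m *\<^sub>R e + x)) = integral\<^sup>L lborel f"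
      using integral_distr[of "(+) (t m *\<^sub>R e)" lborel borel f] fm
      by (simp add: lborel_distr_plus)
    moreover have "Q m = (\<lambda>x. (f (t m *\<^sub>R e + x) - f x) / t m)"
      by (simp add: Q_def fun_eq_iff add.commute)
    ultimately show ?thesis using f by simp
  qed
  ultimately show "integral\<^sup>L lborel g = 0" by (simp add: LIMSEQ_const_iff)
qed

section \<open>Functions with a power singularity at the origin\<close>

text \<open>A singularity of order at most k at the pole, with constants uniform on bounded sets.
  The value at 0 stays free, since functions such as x_i/|x| have no continuous extension there.
  Integrability then amounts to comparing k with the dimension.\<close>

definition sing :: "nat \<Rightarrow> (real^'n::finite \<Rightarrow> real) \<Rightarrow> bool" where
  "sing k f \<longleftrightarrow> continuous_on (- {0}) f \<and>
     (\<forall>R. \<exists>C. \<forall>x. x \<noteq> 0 \<longrightarrow> norm x \<le> R \<longrightarrow> \<bar>f x\<bar> \<le> C / norm x ^ k)"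

lemma sing_bound:
  assumes "sing k f"
  obtains C where "C \<ge> 0" "\<And>x. x \<noteq> 0 \<Longrightarrow> norm x \<le> R \<Longrightarrow> \<bar>f x\<bar> \<le> C / norm x ^ k"
proof -
  obtain C where C: "\<And>x. x \<noteq> 0 \<Longrightarrow> norm x \<le> R \<Longrightarrow> \<bar>f x\<bar> \<le> C / norm x ^ k"
    using assms unfolding sing_def by blast
  have "\<bar>f x\<bar> \<le> \<bar>C\<bar> / norm x ^ k" if "x \<noteq> 0" "norm x \<le> R" for x
    by (rule order_trans[OF C[OF that]]) (simp add: divide_right_mono)
  then show ?thesis using that[of "\<bar>C\<bar>"] by auto
qed

lemma singI:
  assumes "continuous_on (- {0}) f"
    and "\<And>R. R > 0 \<Longrightarrow> \<exists>C. \<forall>x. x \<noteq> 0 \<longrightarrow> norm x \<le> R \<longrightarrow> \<bar>f x\<bar> \<le> C / norm x ^ k"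
  shows "sing k f"
  unfolding sing_def
proof (intro conjI allI)
  fix R :: real
  obtain C where "\<forall>x. x \<noteq> 0 \<longrightarrow> norm x \<le> max 1 R \<longrightarrow> \<bar>f x\<bar> \<le> C / norm x ^ k"
    using assms(2)[of "max 1 R"] by (auto simp: less_max_iff_disj)
  then show "\<exists>C. \<forall>x. x \<noteq> 0 \<longrightarrow> norm x \<le> R \<longrightarrow> \<bar>f x\<bar> \<le> C / norm x ^ k"
    by (intro exI[of _ C]) auto
qed (fact assms(1))

lemma sing_cong:
  assumes "sing k f" "\<And>x. x \<noteq> 0 \<Longrightarrow> f x = g x"
  shows "sing k g"
proof -
  have "continuous_on (- {0}) f \<longleftrightarrow> continuous_on (- {0}) g"
    using assms(2) by (intro continuous_on_cong) auto
  then show ?thesis using assms by (simp add: sing_def)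
qed

lemma sing_mono:
  assumes f: "sing k f" and "k \<le> l"
  shows "sing l f"
proof (rule singI)
  show "continuous_on (- {0}) f" using f by (simp add: sing_def)
  fix R :: real assume R: "R > 0"
  obtain C where C: "C \<ge> 0" "\<And>x. x \<noteq> 0 \<Longrightarrow> norm x \<le> R \<Longrightarrow> \<bar>f x\<bar> \<le> C / norm x ^ k"
    using sing_bound[OF f] by blast
  have "\<bar>f x\<bar> \<le> C * R ^ (l - k) / norm x ^ l" if x: "x \<noteq> 0" "norm x \<le> R" for x
  proof -
    have "C / norm x ^ k = C * norm x ^ (l - k) / norm x ^ l"
      using \<open>k \<le> l\<close> x by (simp add: power_diff)
    also have "\<dots> \<le> C * R ^ (l - k) / norm x ^ l"
      using x C by (intro divide_right_mono mult_left_mono power_mono) auto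
    finally show ?thesis using C(2)[OF x] by simp
  qed
  then show "\<exists>C. \<forall>x. x \<noteq> 0 \<longrightarrow> norm x \<le> R \<longrightarrow> \<bar>f x\<bar> \<le> C / norm x ^ l" by blast
qed

lemma sing_add:
  assumes f: "sing k f" and g: "sing k g"
  shows "sing k (\<lambda>x. f x + g x)"
proof (rule singI)
  show "continuous_on (- {0}) (\<lambda>x. f x + g x)"
    using f g by (auto simp: sing_def intro: continuous_on_add)
  fix R :: real
  obtain C where C: "\<And>x. x \<noteq> 0 \<Longrightarrow> norm x \<le> R \<Longrightarrow> \<bar>f x\<bar> \<le> C / norm x ^ k"
    using sing_bound[OF f] by blast
  obtain D where D: "\<And>x. x \<noteq> 0 \<Longrightarrow> norm x \<le> R \<Longrightarrow> \<bar>g x\<bar> \<le> D / norm x ^ k"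
    using sing_bound[OF g] by blast
  have "\<bar>f x + g x\<bar> \<le> (C + D) / norm x ^ k" if x: "x \<noteq> 0" "norm x \<le> R" for x
    using C[OF x] D[OF x] by (simp add: add_divide_distrib)
  then show "\<exists>C. \<forall>x. x \<noteq> 0 \<longrightarrow> norm x \<le> R \<longrightarrow> \<bar>f x + g x\<bar> \<le> C / norm x ^ k" by blast
qed

lemma sing_mult:
  assumes f: "sing k f" and g: "sing l g"
  shows "sing (k + l) (\<lambda>x. f x * g x)"
proof (rule singI)
  show "continuous_on (- {0}) (\<lambda>x. f x * g x)"
    using f g by (auto simp: sing_def intro: continuous_on_mult)
  fix R :: real
  obtain C where C: "C \<ge> 0" "\<And>x. x \<noteq> 0 \<Longrightarrow> norm x \<le> R \<Longrightarrow> \<bar>f x\<bar> \<le> C / norm x ^ k"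
    using sing_bound[OF f] by blast
  obtain D where D: "\<And>x. x \<noteq> 0 \<Longrightarrow> norm x \<le> R \<Longrightarrow> \<bar>g x\<bar> \<le> D / norm x ^ l"
    using sing_bound[OF g] by blast
  have "\<bar>f x * g x\<bar> \<le> (C * D) / norm x ^ (k + l)" if x: "x \<noteq> 0" "norm x \<le> R" for x
    using mult_mono[OF C(2)[OF x] D[OF x]] C(1) by (simp add: abs_mult power_add)
  then show "\<exists>C. \<forall>x. x \<noteq> 0 \<longrightarrow> norm x \<le> R \<longrightarrow> \<bar>f x * g x\<bar> \<le> C / norm x ^ (k + l)" by blast
qed

lemma sing_const: "sing 0 (\<lambda>x. c)"
  by (rule singI) auto

lemma sing_sum:
  assumes "finite A" "\<And>i. i \<in> A \<Longrightarrow> sing k (f i)"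
  shows "sing k (\<lambda>x. \<Sum>i\<in>A. f i x)"
  using assms
proof (induction A rule: finite_induct)
  case empty
  then show ?case using sing_mono[OF sing_const[of 0]] by simp
next
  case (insert i A)
  then show ?case using sing_add[of k "f i"] by simp
qed

lemma sing_continuous:
  assumes "continuous_on UNIV f"
  shows "sing 0 f"
proof (rule singI)
  show "continuous_on (- {0}) f" by (rule continuous_on_subset[OF assms]) auto
  fix R :: real
  have "bounded (f ` cball 0 R)"
    by (intro compact_imp_bounded compact_continuous_image continuous_on_subset[OF assms]) auto
  then obtain C where "\<And>y. y \<in> f ` cball 0 R \<Longrightarrow> norm y \<le> C" by (auto simp: bounded_iff)
  then show "\<exists>C. \<forall>x. x \<noteq> 0 \<longrightarrow> norm x \<le> R \<longrightarrow> \<bar>f x\<bar> \<le> C / norm x ^ 0"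
    by (intro exI[of _ C]) auto
qed

lemma sing_measurable:
  assumes "sing k (f :: real^'n::finite \<Rightarrow> real)"
  shows "f \<in> borel_measurable lborel"
proof -
  have "(\<lambda>x. indicator (- {0}) x *\<^sub>R f x) \<in> borel_measurable borel"
    using assms by (intro borel_measurable_continuous_on_indicator) (auto simp: sing_def)
  then have "f \<in> borel_measurable borel"
    by (rule measurable_discrete_difference[where X="{0}"]) auto
  then show ?thesis by simp
qed

lemma sing_integrable:
  fixes f :: "real^'n::finite \<Rightarrow> real"
  assumes f: "sing k f" and k: "k < CARD('n)" and zero: "\<And>x. norm x > R \<Longrightarrow> f x = 0"
  shows "integrable lborel f"
proof -
  obtain C where C: "C \<ge> 0" "\<And>x. x \<noteq> 0 \<Longrightarrow> norm x \<le> max 1 R \<Longrightarrow> \<bar>f x\<bar> \<le> C / norm x ^ k"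
    using sing_bound[OF f] by blast
  have "integrable lborel (\<lambda>x::real^'n. C * (indicator (cball 0 (max 1 R)) x / norm x ^ k))"
    using k by (intro integrable_mult_right integrable_inverse_power_norm_cball) auto
  moreover have "AE x in lborel. norm (f x) \<le> norm (C * (indicator (cball 0 (max 1 R)) x / norm x ^ k))"
    using AE_lborel_singleton[of 0]
  proof eventually_elim
    case (elim x)
    show ?case
    proof (cases "norm x \<le> max 1 R")
      case True
      then show ?thesis using C(2)[OF elim True] C(1) by simp
    next
      case False
      then show ?thesis using zero[of x] C(1) by simp
    qed
  qed
  ultimately show ?thesis
    by (rule Bochner_Integration.integrable_bound[OF _ sing_measurable[OF f]])
qed

text \<open>Differentiation costs one order. The derivative family is an explicit argument, so the
  product rule produces usable formulas; nothing is claimed about derivatives at 0.\<close>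

definition sing1 :: "nat \<Rightarrow> (real^'n::finite \<Rightarrow> real) \<Rightarrow> ('n \<Rightarrow> real^'n \<Rightarrow> real) \<Rightarrow> bool" where
  "sing1 k f f' \<longleftrightarrow> sing k f \<and>
     (\<forall>i. sing (Suc k) (f' i) \<and> (\<forall>x. x \<noteq> 0 \<longrightarrow> has_pd f i (f' i x) x))"

lemma sing1_imp_sing: "sing1 k f f' \<Longrightarrow> sing k f"
  by (simp add: sing1_def)

lemma sing1_imp_pdir: "sing1 k f f' \<Longrightarrow> x \<noteq> 0 \<Longrightarrow> pdir i f x = f' i x"
  unfolding sing1_def has_pd_def pdir_def by (blast intro: DERIV_imp_deriv)

lemma sing1_mono: "sing1 k f f' \<Longrightarrow> k \<le> l \<Longrightarrow> sing1 l f f'"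
  unfolding sing1_def by (meson sing_mono Suc_le_mono)

lemma sing1_add:
  assumes "sing1 k f f'" "sing1 k g g'"
  shows "sing1 k (\<lambda>x. f x + g x) (\<lambda>i x. f' i x + g' i x)"
  using assms unfolding sing1_def has_pd_def by (auto intro: sing_add DERIV_add)

lemma sing1_mult:
  assumes f: "sing1 k f f'" and g: "sing1 l g g'"
  shows "sing1 (k + l) (\<lambda>x. f x * g x) (\<lambda>i x. f' i x * g x + f x * g' i x)"
proof -
  have "sing (Suc (k + l)) (\<lambda>x. f' i x * g x + f x * g' i x)" for i
    using sing_mult[of "Suc k" "f' i" l g] sing_mult[of k f "Suc l" "g' i"] f g
    by (auto simp: sing1_def intro: sing_add)
  moreover have "has_pd (\<lambda>x. f x * g x) i (f' i x * g x + f x * g' i x) x" if "x \<noteq> 0" for i x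
    using f g that DERIV_mult'[of "\<lambda>t. f (x + t *\<^sub>R axis i 1)" "f' i x" 0 UNIV "\<lambda>t. g (x + t *\<^sub>R axis i 1)" "g' i x"]
    unfolding sing1_def has_pd_def by (simp add: add.commute)
  ultimately show ?thesis
    using f g sing_mult unfolding sing1_def by blast
qed

lemma sing1_const: "sing1 0 (\<lambda>x. c) (\<lambda>i x. 0)"
  using sing_mono[OF sing_const[of 0]] by (auto simp: sing1_def has_pd_def sing_const)

lemma sing1_cmult:
  assumes "sing1 k f f'"
  shows "sing1 k (\<lambda>x. c * f x) (\<lambda>i x. c * f' i x)"
  using sing1_mult[OF sing1_const[of c] assms] by simp

lemma sing1_sum:
  assumes "finite A" "\<And>j. j \<in> A \<Longrightarrow> sing1 k (f j) (f' j)"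
  shows "sing1 k (\<lambda>x. \<Sum>j\<in>A. f j x) (\<lambda>i x. \<Sum>j\<in>A. f' j i x)"
  using assms
proof (induction A rule: finite_induct)
  case empty
  then show ?case using sing1_mono[OF sing1_const[of 0]] by simp
next
  case (insert j A)
  then show ?case using sing1_add[of k "f j" "f' j"] by simp
qed

section \<open>Direction cosines and radial functions\<close>

lemma norm_line_has_derivative:
  fixes x :: "real^'n::finite"
  assumes "x \<noteq> 0"
  shows "((\<lambda>t. norm (x + t *\<^sub>R axis i 1)) has_real_derivative x $ i / norm x) (at 0)"
proof -
  have "((\<lambda>t. x + t *\<^sub>R axis i 1) has_derivative (\<lambda>t. t *\<^sub>R axis i 1)) (at 0)"
    by (auto intro!: derivative_eq_intros)
  moreover have "(norm has_derivative (\<lambda>y. y \<bullet> sgn x)) (at (x + 0 *\<^sub>R axis i 1))"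
    using has_derivative_norm[OF assms] by simp
  ultimately have "((\<lambda>t. norm (x + t *\<^sub>R axis i 1)) has_derivative (\<lambda>t. (t *\<^sub>R axis i 1) \<bullet> sgn x)) (at 0)"
    by (rule has_derivative_compose)
  moreover have "(t *\<^sub>R axis i 1) \<bullet> sgn x = x $ i / norm x * t" for t
    by (simp add: sgn_div_norm inner_axis' divide_inverse mult_ac)
  ultimately show ?thesis unfolding has_field_derivative_def by (simp only:)
qed

lemma coord_line_has_derivative:
  fixes x :: "real^'n::finite"
  shows "((\<lambda>t. (x + t *\<^sub>R axis i 1) $ j) has_real_derivative (if i = j then 1 else 0)) (at 0)"
  by (auto simp: axis_def intro!: derivative_eq_intros)

text \<open>The direction cosine is homogeneous of degree 0, hence bounded with gradient of order 1.
  Summed over i = j, these derivatives give (N - 1)/r, the Euclidean divergence of the unit radial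
  field.\<close>

lemma sing1_dir:
  fixes j :: "'n::finite"
  shows "sing1 0 (\<lambda>x. x $ j / norm x)
     (\<lambda>i x. ((if i = j then 1 else 0) - (x $ i / norm x) * (x $ j / norm x)) / norm x)"
proof -
  have cont: "continuous_on (- {0}) (\<lambda>x::real^'n. x $ j / norm x)" for j
    by (intro continuous_intros) auto
  have b: "sing 0 (\<lambda>x::real^'n. x $ j / norm x)" for j
    using cont by (rule singI) (auto intro!: exI[of _ 1] simp: abs_div divide_le_eq_1 component_le_norm_cart)
  have c: "sing 1 (\<lambda>x::real^'n. 1 / norm x)"
    by (rule singI) (auto intro!: exI[of _ 1] continuous_intros)
  have "sing (0 + 0) (\<lambda>x::real^'n. (-1) * (x $ i / norm x) * (x $ j / norm x))" for i
    using sing_mult[OF sing_mult[OF sing_const[of "-1"] b[of i]] b[of j]] by simp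
  then have "sing (0 + 1) (\<lambda>x::real^'n. ((if i = j then 1 else 0) + (-1) * (x $ i / norm x) * (x $ j / norm x)) * (1 / norm x))" for i
    by (intro sing_mult sing_add sing_const c) auto
  then have "sing (Suc 0) (\<lambda>x::real^'n. ((if i = j then 1 else 0) - (x $ i / norm x) * (x $ j / norm x)) / norm x)" for i
    by simp
  moreover have "has_pd (\<lambda>x. x $ j / norm x) i (((if i = j then 1 else 0) - (x $ i / norm x) * (x $ j / norm x)) / norm x) x"
    if "x \<noteq> 0" for i and x :: "real^'n"
  proof -
    have "(x + 0 *\<^sub>R axis i 1) = x" by simp
    then show ?thesis unfolding has_pd_def
      using DERIV_divide[OF coord_line_has_derivative[of x i j] norm_line_has_derivative[OF that, of i]] that
      by (simp add: divide_simps mult_ac split: if_splits)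
  qed
  ultimately show ?thesis using b by (simp add: sing1_def)
qed

text \<open>Counterpart of \<open>sing1\<close> on the half-line. Radial coefficients are
  differentiated in one variable, so that the chain rule through |x| is needed only once, in
  \<open>rsing_sing1\<close>.\<close>

definition rsing :: "nat \<Rightarrow> (real \<Rightarrow> real) \<Rightarrow> (real \<Rightarrow> real) \<Rightarrow> bool" where
  "rsing k p p' \<longleftrightarrow> (\<forall>r>0. (p has_real_derivative p' r) (at r)) \<and> continuous_on {0<..} p' \<and>
     (\<forall>R>0. \<exists>C. \<forall>r. 0 < r \<longrightarrow> r \<le> R \<longrightarrow> \<bar>p r\<bar> \<le> C / r ^ k \<and> \<bar>p' r\<bar> \<le> C / r ^ Suc k)"

lemma rsing_sing1:
  assumes "rsing k p p'"
  shows "sing1 k (\<lambda>x::real^'n::finite. p (norm x)) (\<lambda>i x. p' (norm x) * (x $ i / norm x))"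
proof -
  have d: "(p has_real_derivative p' r) (at r)" if "r > 0" for r
    using assms that by (simp add: rsing_def)
  have bd: "\<exists>C. \<forall>r. 0 < r \<longrightarrow> r \<le> R \<longrightarrow> \<bar>p r\<bar> \<le> C / r ^ k \<and> \<bar>p' r\<bar> \<le> C / r ^ Suc k" if "R > 0" for R
    using assms that by (simp add: rsing_def)
  have "continuous_on {0<..} p"
    by (intro continuous_at_imp_continuous_on ballI DERIV_isCont) (auto intro: d)
  then have "continuous_on (- {0}) (\<lambda>x::real^'n. p (norm x))"
    by (rule continuous_on_compose2) (auto intro: continuous_intros)
  then have 1: "sing k (\<lambda>x::real^'n. p (norm x))"
  proof (rule singI)
    fix R :: real assume "R > 0"
    then obtain C where "\<forall>r. 0 < r \<longrightarrow> r \<le> R \<longrightarrow> \<bar>p r\<bar> \<le> C / r ^ k \<and> \<bar>p' r\<bar> \<le> C / r ^ Suc k"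
      using bd by blast
    then show "\<exists>C. \<forall>x::real^'n. x \<noteq> 0 \<longrightarrow> norm x \<le> R \<longrightarrow> \<bar>p (norm x)\<bar> \<le> C / norm x ^ k"
      by (intro exI[of _ C]) simp
  qed
  have "continuous_on {0<..} p'" using assms by (simp add: rsing_def)
  then have "continuous_on (- {0}) (\<lambda>x::real^'n. p' (norm x))"
    by (rule continuous_on_compose2) (auto intro: continuous_intros)
  then have "sing (Suc k) (\<lambda>x::real^'n. p' (norm x))"
  proof (rule singI)
    fix R :: real assume "R > 0"
    then obtain C where "\<forall>r. 0 < r \<longrightarrow> r \<le> R \<longrightarrow> \<bar>p r\<bar> \<le> C / r ^ k \<and> \<bar>p' r\<bar> \<le> C / r ^ Suc k"
      using bd by blast
    then show "\<exists>C. \<forall>x::real^'n. x \<noteq> 0 \<longrightarrow> norm x \<le> R \<longrightarrow> \<bar>p' (norm x)\<bar> \<le> C / norm x ^ Suc k"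
      by (intro exI[of _ C]) simp
  qed
  then have 2: "sing (Suc k) (\<lambda>x::real^'n. p' (norm x) * (x $ i / norm x))" for i
    using sing_mult[OF _ sing1_imp_sing[OF sing1_dir], of "Suc k" "\<lambda>x::real^'n. p' (norm x)" i] by simp
  have "has_pd (\<lambda>x. p (norm x)) i (p' (norm x) * (x $ i / norm x)) x" if "x \<noteq> 0" for i and x :: "real^'n"
    unfolding has_pd_def
    using DERIV_chain2[OF d[of "norm (x + 0 *\<^sub>R axis i 1)"] norm_line_has_derivative[OF that]] that by simp
  with 1 2 show ?thesis by (simp add: sing1_def)
qed

lemma rsing_cong:
  assumes p: "rsing k p p'" and eq: "\<And>r. r > 0 \<Longrightarrow> p r = q r" "\<And>r. r > 0 \<Longrightarrow> p' r = q' r"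
  shows "rsing k q q'"
  unfolding rsing_def
proof (intro conjI allI impI)
  fix r :: real assume r: "r > 0"
  then have "(p has_real_derivative q' r) (at r)" using p eq by (auto simp: rsing_def)
  then show "(q has_real_derivative q' r) (at r)"
    by (rule has_field_derivative_transform_within_open[of _ _ _ "{0<..}"]) (use eq r in auto)
next
  have "continuous_on {0<..} p'" using p by (simp add: rsing_def)
  then show "continuous_on {0<..} q'" by (rule continuous_on_eq) (simp add: eq)
next
  fix R :: real assume "R > 0"
  then show "\<exists>C. \<forall>r. 0 < r \<longrightarrow> r \<le> R \<longrightarrow> \<bar>q r\<bar> \<le> C / r ^ k \<and> \<bar>q' r\<bar> \<le> C / r ^ Suc k"
    using p eq by (simp add: rsing_def)
qed

lemma rsing_bound:
  assumes "rsing k p p'" "R > 0"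
  obtains C where "C \<ge> 0" "\<And>r. 0 < r \<Longrightarrow> r \<le> R \<Longrightarrow> \<bar>p r\<bar> \<le> C / r ^ k"
    "\<And>r. 0 < r \<Longrightarrow> r \<le> R \<Longrightarrow> \<bar>p' r\<bar> \<le> C / r ^ Suc k"
proof -
  obtain C where C: "\<And>r. 0 < r \<Longrightarrow> r \<le> R \<Longrightarrow> \<bar>p r\<bar> \<le> C / r ^ k \<and> \<bar>p' r\<bar> \<le> C / r ^ Suc k"
    using assms unfolding rsing_def by blast
  have "0 \<le> C / R ^ k" using C[of R] assms by (meson abs_ge_zero order_refl order_trans)
  then have "C \<ge> 0" using assms by (auto simp: zero_le_divide_iff not_le dest: zero_less_power[of R k])
  then show ?thesis using that[of C] C by blast
qed

lemma rsing_mono: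
  assumes p: "rsing k p p'" and "k \<le> l"
  shows "rsing l p p'"
proof -
  have "\<exists>C. \<forall>r. 0 < r \<longrightarrow> r \<le> R \<longrightarrow> \<bar>p r\<bar> \<le> C / r ^ l \<and> \<bar>p' r\<bar> \<le> C / r ^ Suc l" if R: "R > 0" for R
  proof -
    obtain C where C: "C \<ge> 0" "\<And>r. 0 < r \<Longrightarrow> r \<le> R \<Longrightarrow> \<bar>p r\<bar> \<le> C / r ^ k"
      "\<And>r. 0 < r \<Longrightarrow> r \<le> R \<Longrightarrow> \<bar>p' r\<bar> \<le> C / r ^ Suc k"
      by (rule rsing_bound[OF p R]) (rule that)
    have *: "C / r ^ m \<le> C * R ^ (l - k) / r ^ (m + (l - k))" if "0 < r" "r \<le> R" for r m
    proof -
      have "C / r ^ m = C * r ^ (l - k) / r ^ (m + (l - k))" using that by (simp add: power_add)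
      also have "\<dots> \<le> C * R ^ (l - k) / r ^ (m + (l - k))"
        using that C by (intro divide_right_mono mult_left_mono power_mono) auto
      finally show ?thesis .
    qed
    have "\<bar>p r\<bar> \<le> C * R ^ (l - k) / r ^ l \<and> \<bar>p' r\<bar> \<le> C * R ^ (l - k) / r ^ Suc l" if r: "0 < r" "r \<le> R" for r
      using *[OF r, of k] *[OF r, of "Suc k"] C(2,3)[OF r] \<open>k \<le> l\<close> by (simp del: power_Suc)
    then show ?thesis by blast
  qed
  then show ?thesis using p by (auto simp: rsing_def)
qed

lemma rsing_add:
  assumes p: "rsing k p p'" and q: "rsing k q q'"
  shows "rsing k (\<lambda>r. p r + q r) (\<lambda>r. p' r + q' r)"
proof -
  have "\<exists>C. \<forall>r. 0 < r \<longrightarrow> r \<le> R \<longrightarrow> \<bar>p r + q r\<bar> \<le> C / r ^ k \<and> \<bar>p' r + q' r\<bar> \<le> C / r ^ Suc k" if R: "R > 0" for R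
  proof -
    obtain C where C: "C \<ge> 0" "\<And>r. 0 < r \<Longrightarrow> r \<le> R \<Longrightarrow> \<bar>p r\<bar> \<le> C / r ^ k"
      "\<And>r. 0 < r \<Longrightarrow> r \<le> R \<Longrightarrow> \<bar>p' r\<bar> \<le> C / r ^ Suc k"
      by (rule rsing_bound[OF p R]) (rule that)
    obtain E where E: "E \<ge> 0" "\<And>r. 0 < r \<Longrightarrow> r \<le> R \<Longrightarrow> \<bar>q r\<bar> \<le> E / r ^ k"
      "\<And>r. 0 < r \<Longrightarrow> r \<le> R \<Longrightarrow> \<bar>q' r\<bar> \<le> E / r ^ Suc k"
      by (rule rsing_bound[OF q R]) (rule that)
    have "\<bar>p r + q r\<bar> \<le> (C + E) / r ^ k \<and> \<bar>p' r + q' r\<bar> \<le> (C + E) / r ^ Suc k" if r: "0 < r" "r \<le> R" for r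
      using C(2,3)[OF r] E(2,3)[OF r] unfolding add_divide_distrib by linarith
    then show ?thesis by blast
  qed
  then show ?thesis
    using p q by (auto simp: rsing_def intro!: DERIV_add continuous_on_add)
qed

lemma rsing_mult:
  assumes p: "rsing k p p'" and q: "rsing l q q'"
  shows "rsing (k + l) (\<lambda>r. p r * q r) (\<lambda>r. p' r * q r + p r * q' r)"
proof -
  have dp: "(p has_real_derivative p' r) (at r)" and dq: "(q has_real_derivative q' r) (at r)" if "r > 0" for r
    using p q that by (auto simp: rsing_def)
  have cont: "continuous_on {0<..} p" "continuous_on {0<..} q"
    by (auto intro!: continuous_at_imp_continuous_on DERIV_isCont intro: dp dq)
  have "\<exists>C. \<forall>r. 0 < r \<longrightarrow> r \<le> R \<longrightarrow> \<bar>p r * q r\<bar> \<le> C / r ^ (k + l) \<and>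
      \<bar>p' r * q r + p r * q' r\<bar> \<le> C / r ^ Suc (k + l)" if R: "R > 0" for R
  proof -
    obtain C where C: "C \<ge> 0" "\<And>r. 0 < r \<Longrightarrow> r \<le> R \<Longrightarrow> \<bar>p r\<bar> \<le> C / r ^ k"
      "\<And>r. 0 < r \<Longrightarrow> r \<le> R \<Longrightarrow> \<bar>p' r\<bar> \<le> C / r ^ Suc k"
      by (rule rsing_bound[OF p R]) (rule that)
    obtain E where E: "E \<ge> 0" "\<And>r. 0 < r \<Longrightarrow> r \<le> R \<Longrightarrow> \<bar>q r\<bar> \<le> E / r ^ l"
      "\<And>r. 0 < r \<Longrightarrow> r \<le> R \<Longrightarrow> \<bar>q' r\<bar> \<le> E / r ^ Suc l"
      by (rule rsing_bound[OF q R]) (rule that)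
    have "\<bar>p r * q r\<bar> \<le> 2 * (C * E) / r ^ (k + l) \<and>
      \<bar>p' r * q r + p r * q' r\<bar> \<le> 2 * (C * E) / r ^ Suc (k + l)" if r: "0 < r" "r \<le> R" for r
    proof
      have "\<bar>p r * q r\<bar> \<le> C * E / r ^ (k + l)"
        using mult_mono[OF C(2)[OF r] E(2)[OF r]] C(1) r by (simp add: abs_mult power_add)
      also have "\<dots> \<le> 2 * (C * E) / r ^ (k + l)"
        using C(1) E(1) r by (intro divide_right_mono) auto
      finally show "\<bar>p r * q r\<bar> \<le> 2 * (C * E) / r ^ (k + l)" .
      have "\<bar>p' r * q r\<bar> \<le> C * E / r ^ Suc (k + l)"
        using mult_mono[OF C(3)[OF r] E(2)[OF r]] C(1) r by (simp add: abs_mult power_add mult_ac)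
      moreover have "\<bar>p r * q' r\<bar> \<le> C * E / r ^ Suc (k + l)"
        using mult_mono[OF C(2)[OF r] E(3)[OF r]] C(1) r by (simp add: abs_mult power_add mult_ac)
      ultimately show "\<bar>p' r * q r + p r * q' r\<bar> \<le> 2 * (C * E) / r ^ Suc (k + l)" by simp
    qed
    then show ?thesis by blast
  qed
  moreover have "((\<lambda>r. p r * q r) has_real_derivative p' r * q r + p r * q' r) (at r)" if "r > 0" for r
    using DERIV_mult'[OF dp[OF that] dq[OF that]] by (simp add: add.commute)
  ultimately show ?thesis
    using p q cont by (auto simp: rsing_def intro!: continuous_on_add continuous_on_mult)
qed

lemma rsing_const: "rsing 0 (\<lambda>r. c) (\<lambda>r. 0)"
  unfolding rsing_def
proof (intro conjI allI impI)
  fix R :: real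
  show "\<exists>C. \<forall>r. 0 < r \<longrightarrow> r \<le> R \<longrightarrow> \<bar>c\<bar> \<le> C / r ^ 0 \<and> \<bar>0\<bar> \<le> C / r ^ Suc 0"
    by (rule exI[of _ "\<bar>c\<bar>"]) simp
qed auto

lemma rsing_cmult: "rsing k p p' \<Longrightarrow> rsing k (\<lambda>r. c * p r) (\<lambda>r. c * p' r)"
  using rsing_mult[OF rsing_const[of c], of k p p'] by simp

lemma rsing_inverse: "rsing 1 (\<lambda>r. 1 / r) (\<lambda>r. - 1 / r\<^sup>2)"
  unfolding rsing_def
proof (intro conjI allI impI)
  show "continuous_on {0<..} (\<lambda>r::real. - 1 / r\<^sup>2)" by (intro continuous_intros) auto
  fix r :: real assume "r > 0"
  then show "((\<lambda>r. 1 / r) has_real_derivative - 1 / r\<^sup>2) (at r)"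
    by (auto intro!: derivative_eq_intros simp: power2_eq_square)
next
  fix R :: real
  show "\<exists>C. \<forall>r. 0 < r \<longrightarrow> r \<le> R \<longrightarrow> \<bar>1 / r\<bar> \<le> C / r ^ 1 \<and> \<bar>- 1 / r\<^sup>2\<bar> \<le> C / r ^ Suc 1"
    by (intro exI[of _ 1]) (simp add: power2_eq_square)
qed

lemma rsing_power:
  assumes "rsing 0 p p'"
  shows "rsing 0 (\<lambda>r. p r ^ m) (\<lambda>r. real m * p r ^ (m - 1) * p' r)"
proof (induction m)
  case 0
  then show ?case using rsing_const[of 1] by simp
next
  case (Suc m)
  show ?case
    using rsing_mult[OF assms Suc.IH] unfolding add_0
    by (rule rsing_cong) (cases m; simp add: algebra_simps)+
qed

section \<open>The divergence theorem across a singularity at the pole\<close>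

lemma sing1_eq_0:
  assumes f: "sing1 k f f'" and zero: "\<And>x. norm x > R \<Longrightarrow> f x = 0" and x: "norm x > R" "x \<noteq> 0"
  shows "f' i x = 0"
proof -
  have "((\<lambda>t. f (x + t *\<^sub>R axis i 1)) has_real_derivative 0) (at 0)"
  proof (rule has_field_derivative_transform_within_open[of "\<lambda>_. 0" _ _ "{t. norm (x + t *\<^sub>R axis i 1) > R}"])
    show "open {t. norm (x + t *\<^sub>R axis i 1) > R}"
      by (intro open_Collect_less continuous_intros)
  qed (use x zero in auto)
  then show ?thesis using f x by (auto simp: sing1_def has_pd_def intro: DERIV_unique)
qed

text \<open>In the proof, the cutoff s^3/(s+e)^3 with s = |x|^2 removes a singularity of order 3 at the origin;
  its derivative is O(1/|x|) uniformly in e, which makes the limit e -> 0 dominated.\<close>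

lemma integral_sing1_partial_eq_0:
  fixes f :: "real^'n::finite \<Rightarrow> real"
  assumes N: "CARD('n) \<ge> 5" and f: "sing1 3 f f'" and zero: "\<And>x. norm x > R \<Longrightarrow> f x = 0"
  shows "integrable lborel (f' i)" "integral\<^sup>L lborel (f' i) = 0"
proof -
  have sf: "sing 3 f" and sf': "sing 4 (f' i)" using f by (auto simp: sing1_def)
  have pd: "has_pd f i (f' i x) x" if "x \<noteq> 0" for x using f that by (simp add: sing1_def)
  have zero': "f' i x = 0" if "norm x > max 0 R" for x
    using that by (intro sing1_eq_0[OF f zero]) auto
  show int': "integrable lborel (f' i)"
    by (rule sing_integrable[OF sf', where R="max 0 R"]) (use N zero' in auto)
  define R' where "R' = max 1 R"
  have R'1: "R' \<ge> 1" by (simp add: R'_def)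
  obtain C where C: "C \<ge> 0" "\<And>x. x \<noteq> 0 \<Longrightarrow> norm x \<le> R' \<Longrightarrow> \<bar>f x\<bar> \<le> C / norm x ^ 3"
    by (rule sing_bound[OF sf, of R']) (rule that)
  obtain E where E: "E \<ge> 0" "\<And>x. x \<noteq> 0 \<Longrightarrow> norm x \<le> R' \<Longrightarrow> \<bar>f' i x\<bar> \<le> E / norm x ^ 4"
    by (rule sing_bound[OF sf', of R']) (rule that)
  \<comment> \<open>The cube makes \<open>k e x * f x\<close> of size O(|x|^3) for fixed
    \<open>e\<close>, hence differentiable at 0; a square would leave only O(|x|). The function
    \<open>k'\<close> is the i-th partial derivative of \<open>k\<close>.\<close>
  define k where "k e x = ((norm x)\<^sup>2 / ((norm x)\<^sup>2 + e)) ^ 3" for e and x :: "real^'n"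
  define k' where "k' e x = 6 * x $ i * e * (norm x) ^ 4 / ((norm x)\<^sup>2 + e) ^ 4" for e and x :: "real^'n"
  \<comment> \<open>At the origin \<open>f\<close> and \<open>f' i\<close> have arbitrary values,
    while the true derivative of the regularised product there is 0.\<close>
  define g where "g e x = (if x = 0 then 0 else k' e x * f x + k e x * f' i x)" for e x
  have line: "(norm (x + t *\<^sub>R axis i 1))\<^sup>2 = (norm x)\<^sup>2 + 2 * t * x $ i + t\<^sup>2" for x :: "real^'n" and t
    unfolding power2_norm_eq_inner by (simp add: inner_add_left inner_add_right inner_axis inner_axis' power2_eq_square distrib_left)
  have k_pd: "has_pd (k e) i (k' e x) x" if e: "e > 0" for e x
  proof -
    have s: "(norm x)\<^sup>2 + e > 0" using e by (simp add: add_nonneg_pos)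
    have "((\<lambda>t. (((norm x)\<^sup>2 + 2 * t * x $ i + t\<^sup>2) / ((norm x)\<^sup>2 + 2 * t * x $ i + t\<^sup>2 + e)) ^ 3) has_real_derivative k' e x) (at 0)"
      using s unfolding k'_def
      by (auto intro!: derivative_eq_intros) (simp add: divide_simps, simp add: algebra_simps power_numeral_reduce)
    then show ?thesis unfolding has_pd_def k_def line .
  qed
  have k01: "0 \<le> k e x" "k e x \<le> 1" if "e > 0" for e x
    using that by (auto simp: k_def divide_le_eq_1 intro!: power_le_one add_nonneg_pos)
  have k3: "k e x \<le> norm x ^ 6 / e ^ 3" if e: "e > 0" for e x
  proof -
    have "(norm x)\<^sup>2 / ((norm x)\<^sup>2 + e) \<le> (norm x)\<^sup>2 / e"
      using e by (intro divide_left_mono) (auto intro!: mult_pos_pos add_nonneg_pos)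
    then have "k e x \<le> ((norm x)\<^sup>2 / e) ^ 3"
      unfolding k_def using e by (intro power_mono) auto
    then show ?thesis by (simp add: power_divide flip: power_mult)
  qed
  have k'r: "\<bar>k' e x\<bar> \<le> 6 * norm x * ((norm x)^4 * e / ((norm x)\<^sup>2 + e) ^ 4)" if e: "e > 0" for e x
  proof -
    have "\<bar>k' e x\<bar> = 6 * \<bar>x $ i\<bar> * ((norm x)^4 * e / ((norm x)\<^sup>2 + e) ^ 4)"
      using e by (simp add: k'_def abs_mult)
    also have "\<dots> \<le> 6 * norm x * ((norm x)^4 * e / ((norm x)\<^sup>2 + e) ^ 4)"
      using e by (intro mult_right_mono mult_left_mono component_le_norm_cart) auto
    finally show ?thesis .
  qed
  have k'1: "\<bar>k' e x\<bar> \<le> 6 / norm x" if e: "e > 0" and x: "x \<noteq> 0" for e x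
  proof -
    define s where "s = (norm x)\<^sup>2"
    have s: "s > 0" using x by (simp add: s_def)
    have "s ^ 2 * e / (s + e) ^ 4 \<le> (s + e)\<^sup>2 * (s + e) / (s + e) ^ 4"
      using s e by (intro divide_right_mono mult_mono power_mono) auto
    also have "\<dots> = 1 / (s + e)" using s e by (simp add: divide_simps power_numeral_reduce)
    also have "\<dots> \<le> 1 / s" using s e by (simp add: frac_le)
    finally have "6 * norm x * (s ^ 2 * e / (s + e) ^ 4) \<le> 6 * norm x * (1 / s)"
      by (intro mult_left_mono) auto
    also have "\<dots> = 6 / norm x" using x by (simp add: s_def power2_eq_square)
    finally show ?thesis using k'r[OF e, of x] unfolding s_def by (simp flip: power_mult)
  qed
  have k'3: "\<bar>k' e x\<bar> \<le> 6 * norm x ^ 5 / e ^ 3" if e: "e > 0" for e x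
  proof -
    have "norm x ^ 4 * e / ((norm x)\<^sup>2 + e) ^ 4 \<le> norm x ^ 4 * e / e ^ 4"
      using e by (intro divide_left_mono power_mono) (auto intro!: mult_pos_pos zero_less_power add_nonneg_pos)
    also have "\<dots> = norm x ^ 4 / e ^ 3" using e by (simp add: power_numeral_reduce)
    finally have "6 * norm x * ((norm x)^4 * e / ((norm x)\<^sup>2 + e) ^ 4) \<le> 6 * norm x * (norm x ^ 4 / e ^ 3)"
      by (intro mult_left_mono) auto
    then show ?thesis using k'r[OF e, of x] by (simp add: power_numeral_reduce)
  qed
  have kf: "\<bar>k e x * f x\<bar> \<le> C / e ^ 3 * norm x ^ 3" if e: "e > 0" and x: "norm x \<le> R'" for e x
  proof (cases "x = 0")
    case False
    have "\<bar>k e x * f x\<bar> \<le> norm x ^ 6 / e ^ 3 * (C / norm x ^ 3)"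
      unfolding abs_mult using k01(1)[OF e] k3[OF e] C(2)[OF False x] e by (intro mult_mono) auto
    also have "\<dots> = C / e ^ 3 * norm x ^ 3" using False by (simp add: divide_simps power_numeral_reduce)
    finally show ?thesis .
  qed (simp add: k_def)
  have g_pd: "has_pd (\<lambda>x. k e x * f x) i (g e x) x" if e: "e > 0" for e x
  proof (cases "x = 0")
    case False
    then show ?thesis
      using DERIV_mult'[OF k_pd[OF e, of x, unfolded has_pd_def] pd[OF False, unfolded has_pd_def]]
      by (simp add: has_pd_def g_def add.commute)
  next
    \<comment> \<open>Since \<open>k e\<close> vanishes at 0 whatever \<open>f 0\<close> is, the
      difference quotient at the origin is O(t^2).\<close>
    case True
    have "((\<lambda>t. (k e (t *\<^sub>R axis i 1) * f (t *\<^sub>R axis i 1)) / t) \<longlongrightarrow> 0) (at 0)"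
    proof (rule Lim_null_comparison)
      have "\<bar>k e (t *\<^sub>R axis i 1) * f (t *\<^sub>R axis i 1)\<bar> / \<bar>t\<bar> \<le> C / e ^ 3 * \<bar>t\<bar> ^ 2"
        if "t \<noteq> 0" "\<bar>t\<bar> < 1" for t
      proof -
        have "\<bar>k e (t *\<^sub>R axis i 1) * f (t *\<^sub>R axis i 1)\<bar> \<le> C / e ^ 3 * \<bar>t\<bar> ^ 3"
          using kf[OF e, of "t *\<^sub>R axis i 1"] that R'1 by simp
        then have "\<bar>k e (t *\<^sub>R axis i 1) * f (t *\<^sub>R axis i 1)\<bar> / \<bar>t\<bar> \<le> C / e ^ 3 * \<bar>t\<bar> ^ 3 / \<bar>t\<bar>"
          by (rule divide_right_mono) simp
        also have "\<dots> = C / e ^ 3 * \<bar>t\<bar> ^ 2" using that by (simp add: power_numeral_reduce)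
        finally show ?thesis .
      qed
      then show "\<forall>\<^sub>F t in at 0. norm ((k e (t *\<^sub>R axis i 1) * f (t *\<^sub>R axis i 1)) / t) \<le> C / e ^ 3 * \<bar>t\<bar> ^ 2"
        unfolding eventually_at by (intro exI[of _ 1]) (auto simp: dist_real_def)
      show "((\<lambda>t. C / e ^ 3 * \<bar>t\<bar> ^ 2) \<longlongrightarrow> 0) (at (0::real))"
        using e by (auto intro!: tendsto_eq_intros)
    qed
    then show ?thesis using True by (simp add: has_pd_def DERIV_def g_def k_def)
  qed
  \<comment> \<open>Uniform in \<open>e\<close>: the cutoff gradient contributes 1/|x| against
    |x|^-3, and the cutoff itself is at most 1 against |x|^-4. This is the dominating function as
    \<open>e\<close> tends to 0, integrable because N >= 5.\<close>
  have g_le: "\<bar>g e x\<bar> \<le> (6 * C + E) / norm x ^ 4" if e: "e > 0" and x: "x \<noteq> 0" "norm x \<le> R'" for e x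
  proof -
    have "\<bar>k' e x * f x\<bar> \<le> 6 / norm x * (C / norm x ^ 3)"
      unfolding abs_mult by (intro mult_mono k'1 C e x) auto
    moreover have "6 / norm x * (C / norm x ^ 3) = 6 * C / norm x ^ 4"
      by (simp add: power_numeral_reduce)
    moreover have "\<bar>k e x * f' i x\<bar> \<le> 1 * (E / norm x ^ 4)"
      unfolding abs_mult using k01[OF e, of x] by (intro mult_mono E x) auto
    ultimately have "\<bar>k' e x * f x + k e x * f' i x\<bar> \<le> (6 * C + E) / norm x ^ 4"
      unfolding add_divide_distrib by linarith
    then show ?thesis using x by (simp add: g_def)
  qed
  have g_zero: "g e x = 0" if "norm x > R'" for e x
    using that zero zero' by (simp add: g_def R'_def)
  \<comment> \<open>This bound degenerates as \<open>e\<close> tends to 0. It serves only to apply,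
    for each fixed \<open>e\<close>, the vanishing theorem for bounded derivatives.\<close>
  have g_bd: "\<bar>g e x\<bar> \<le> (6 * C + E) * R' ^ 2 / e ^ 3" if e: "e > 0" for e x
  proof (cases "x = 0 \<or> norm x > R'")
    case True
    then have "g e x = 0" by (elim disjE) (simp add: g_def, rule g_zero)
    then show ?thesis using C(1) E(1) e by simp
  next
    case False
    then have x: "x \<noteq> 0" "norm x \<le> R'" by auto
    have "\<bar>k' e x * f x\<bar> \<le> 6 * norm x ^ 5 / e ^ 3 * (C / norm x ^ 3)"
      unfolding abs_mult using e by (intro mult_mono k'3 C x) auto
    moreover have "6 * norm x ^ 5 / e ^ 3 * (C / norm x ^ 3) = 6 * C * norm x ^ 2 / e ^ 3"
      using x by (simp add: power_numeral_reduce)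
    moreover have "\<bar>k e x * f' i x\<bar> \<le> norm x ^ 6 / e ^ 3 * (E / norm x ^ 4)"
      unfolding abs_mult using k01[OF e, of x] k3[OF e, of x] e by (intro mult_mono E x) auto
    moreover have "norm x ^ 6 / e ^ 3 * (E / norm x ^ 4) = E * norm x ^ 2 / e ^ 3"
      using x by (simp add: power_numeral_reduce)
    ultimately have "\<bar>k' e x * f x + k e x * f' i x\<bar> \<le> (6 * C + E) * norm x ^ 2 / e ^ 3"
      unfolding add_divide_distrib distrib_right by linarith
    then have "\<bar>g e x\<bar> \<le> (6 * C + E) * norm x ^ 2 / e ^ 3" using x by (simp add: g_def)
    also have "\<dots> \<le> (6 * C + E) * R' ^ 2 / e ^ 3"
      using C(1) E(1) e x by (intro divide_right_mono mult_left_mono power_mono) auto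
    finally show ?thesis .
  qed
  have k_meas: "k e \<in> borel_measurable lborel" if "e > 0" for e
  proof -
    have "(norm x)\<^sup>2 + e \<noteq> 0" for x :: "real^'n"
      using that by (metis add_nonneg_pos less_irrefl zero_le_power2)
    then have "continuous_on UNIV (k e)"
      unfolding k_def by (intro continuous_intros) auto
    then show ?thesis by (simp add: borel_measurable_continuous_onI)
  qed
  have int_kf: "integrable lborel (\<lambda>x. k e x * f x)" if e: "e > 0" for e
  proof (rule Bochner_Integration.integrable_bound)
    show "integrable lborel f" using sing_integrable[OF sf _ zero] N by simp
    show "(\<lambda>x. k e x * f x) \<in> borel_measurable lborel"
      using k_meas[OF e] sing_measurable[OF sf] by (rule borel_measurable_times)
    have "\<bar>k e x\<bar> * \<bar>f x\<bar> \<le> 1 * \<bar>f x\<bar>" for x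
      using k01[OF e, of x] by (intro mult_right_mono) auto
    then show "AE x in lborel. norm (k e x * f x) \<le> norm (f x)" by (simp add: abs_mult)
  qed
  have g_int: "g e \<in> borel_measurable lborel" "integral\<^sup>L lborel (g e) = 0" if e: "e > 0" for e
    using integral_partial_derivative_eq_0[OF int_kf[OF e] g_pd[OF e] g_bd[OF e], of R] zero by auto
  define e where "e m = 1 / real (Suc m)" for m
  have e0: "e m > 0" for m by (simp add: e_def)
  have elim: "e \<longlonglongrightarrow> 0" unfolding e_def by (rule LIMSEQ_Suc[OF lim_1_over_n])
  have g_lim: "(\<lambda>m. g (e m) x) \<longlonglongrightarrow> f' i x" if x: "x \<noteq> 0" for x
  proof -
    have "(\<lambda>m. k (e m) x) \<longlonglongrightarrow> ((norm x)\<^sup>2 / ((norm x)\<^sup>2 + 0)) ^ 3"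
      unfolding k_def using x by (intro tendsto_intros elim) auto
    moreover have "(\<lambda>m. k' (e m) x) \<longlonglongrightarrow> 6 * x $ i * 0 * (norm x) ^ 4 / ((norm x)\<^sup>2 + 0) ^ 4"
      unfolding k'_def using x by (intro tendsto_intros elim) auto
    ultimately have "(\<lambda>m. k' (e m) x * f x + k (e m) x * f' i x) \<longlonglongrightarrow> 0 * f x + 1 * f' i x"
      using x by (intro tendsto_intros) auto
    then show ?thesis using x by (simp add: g_def)
  qed
  have "(\<lambda>m. integral\<^sup>L lborel (g (e m))) \<longlonglongrightarrow> integral\<^sup>L lborel (f' i)"
  proof (rule integral_dominated_convergence[where w="\<lambda>x. (6 * C + E) * (indicator (cball 0 R') x / norm x ^ 4)"])
    show "integrable lborel (\<lambda>x::real^'n. (6 * C + E) * (indicator (cball 0 R') x / norm x ^ 4))"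
      using N R'1 by (intro integrable_mult_right integrable_inverse_power_norm_cball) auto
    show "AE x in lborel. (\<lambda>m. g (e m) x) \<longlonglongrightarrow> f' i x"
      using AE_lborel_singleton[of 0] by eventually_elim (rule g_lim)
    show "AE x in lborel. norm (g (e m) x) \<le> (6 * C + E) * (indicator (cball 0 R') x / norm x ^ 4)" for m
      using AE_lborel_singleton[of 0]
    proof eventually_elim
      case (elim x)
      then show ?case using g_le[OF e0 elim, of m] g_zero[of x] by (cases "norm x \<le> R'") auto
    qed
  qed (use sing_measurable[OF sf'] g_int(1)[OF e0] in auto)
  then show "integral\<^sup>L lborel (f' i) = 0"
    using g_int(2)[OF e0] by (simp add: LIMSEQ_const_iff)
qed

section \<open>The profile and the pointwise inequality\<close>

lemma radial_potential_lower_bound: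
  fixes n r h h1 :: real
  assumes n: "n \<ge> 4" and r: "r > 0" and h: "h \<ge> 1" "h \<ge> 1 / r" and h1: "h1 \<ge> 1 - h\<^sup>2"
  defines "lam \<equiv> n\<^sup>2 / 4" and "b \<equiv> 1 / (4 * r\<^sup>2)"
  defines "p1 \<equiv> n * h / 2 - 1 / (2 * r)" and "p2 \<equiv> n * h / 2 - 3 / (2 * r)"
  defines "q \<equiv> - lam * n * h + lam / r - n * h / (4 * r\<^sup>2) + 1 / (4 * r ^ 3)"
    and "q1 \<equiv> - lam * n * h1 - lam / r\<^sup>2 - n * h1 / (4 * r\<^sup>2) + n * h / (2 * r ^ 3) - 3 / (4 * r ^ 4)"
  shows "lam\<^sup>2 + lam / (4 * r\<^sup>2) + (n - 3)\<^sup>2 / (16 * r ^ 4)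
    \<le> - (lam + b)\<^sup>2 - 2 * lam * p1\<^sup>2 - 2 * b * p2\<^sup>2 - q1 - n * h * q"
proof -
  \<comment> \<open>In the variables k = h^2 and t = 1/r^2 all terms linear in h cancel. The right
    side is affine in \<open>h1\<close> with positive coefficient n (lam + t/4), so
    \<open>h1\<close> may be replaced by its lower bound 1 - k.\<close>
  define y where "y = 1 / r"
  define k where "k = h\<^sup>2"
  \<comment> \<open>This is 2 lam - n, the net coefficient of (k - 1)(lam + t/4): the gain 2 lam
    from the squares minus the loss n from the lower bound on \<open>h1\<close>.\<close>
  define m where "m = n * (n - 2) / 2"
  define t where "t = y\<^sup>2"
  have y: "y > 0" using r by (simp add: y_def)
  have t0: "t > 0" using y by (simp add: t_def)
  have k1: "k \<ge> 1" unfolding k_def using h by (simp add: one_le_power)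
  have kt: "k \<ge> t" unfolding k_def t_def y_def using h r by (intro power_mono) auto
  have m0: "m \<ge> 0" using n by (simp add: m_def)
  have lam: "4 * lam = n\<^sup>2" by (simp add: lam_def)
  have eq: "- (lam + b)\<^sup>2 - 2 * lam * p1\<^sup>2 - 2 * b * p2\<^sup>2 - q1 - n * h * q
     = lam * n\<^sup>2 * k / 2 + n\<^sup>2 * k * t / 8 + n * h1 * (lam + t / 4) - lam\<^sup>2 - 7 / 16 * t\<^sup>2"
    unfolding b_def p1_def p2_def q_def q1_def k_def t_def y_def using r
    by (simp add: field_simps power_numeral_reduce)
  have "n * (1 - k) * (lam + t / 4) \<le> n * h1 * (lam + t / 4)"
    using n h1 t0 by (intro mult_right_mono mult_left_mono) (auto simp: k_def lam_def)
  moreover have "lam * n\<^sup>2 * k / 2 + n\<^sup>2 * k * t / 8 + n * (1 - k) * (lam + t / 4)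
    = 2 * lam\<^sup>2 + lam * t / 2 + m * (k - 1) * (lam + t / 4)"
    unfolding lam_def m_def by (simp add: field_simps power_numeral_reduce)
  \<comment> \<open>Here n^2 - 6 n + 16 = (n - 3)^2 + 7 combines the wanted coefficient of t^2/16
    with the deficit -7/16 t^2. It is paid for by half of the available lam t/2 and by the term with
    k - 1.\<close>
  moreover have "(n\<^sup>2 - 6 * n + 16) * t\<^sup>2 / 16 \<le> lam * t / 4 + m * (k - 1) * (lam + t / 4)"
  \<comment> \<open>For r >= 1, t^2 <= t and lam t/4 alone suffices. For r < 1, split t^2 = t (t -
    1) + t: the linear part is again covered by lam t/4, and the rest by k - 1 >= t - 1, since n >=
    4 gives n^2 - 6 n + 16 <= 4 m.\<close>
  proof (cases "t \<le> 1")
    case True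
    have "(n\<^sup>2 - 6 * n + 16) * t\<^sup>2 \<le> n\<^sup>2 * t\<^sup>2" using n by (intro mult_right_mono) auto
    also have "\<dots> \<le> n\<^sup>2 * t" using True t0 by (intro mult_left_mono) (auto simp: power2_eq_square mult_le_cancel_right1)
    also have "\<dots> = 4 * (lam * t)" using lam by simp
    finally have "(n\<^sup>2 - 6 * n + 16) * t\<^sup>2 / 16 \<le> lam * t / 4" by linarith
    moreover have "0 \<le> m * (k - 1) * (lam + t / 4)" using m0 k1 t0 by (simp add: lam_def)
    ultimately show ?thesis by linarith
  next
    case False
    have "4 * 4 \<le> n * n" using n by (intro mult_mono) auto
    then have nn: "n\<^sup>2 \<ge> 16" by (simp add: power2_eq_square)
    have "(n\<^sup>2 - 6 * n + 16) * (t * (t - 1)) \<le> 4 * m * (t * (t - 1))"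
      using n nn False by (intro mult_right_mono) (auto simp: m_def field_simps power2_eq_square)
    also have "\<dots> = 16 * (m * (t - 1) * (t / 4))" by simp
    also have "\<dots> \<le> 16 * (m * (k - 1) * (lam + t / 4))"
      using m0 kt t0 False by (intro mult_left_mono mult_mono) (auto simp: lam_def)
    finally have "(n\<^sup>2 - 6 * n + 16) * (t * (t - 1)) \<le> 16 * (m * (k - 1) * (lam + t / 4))" .
    moreover have "(n\<^sup>2 - 6 * n + 16) * t \<le> n\<^sup>2 * t" using n t0 by (intro mult_right_mono) auto
    moreover have "n\<^sup>2 * t = 4 * (lam * t)" using lam by simp
    moreover have "(n\<^sup>2 - 6 * n + 16) * t\<^sup>2 = (n\<^sup>2 - 6 * n + 16) * (t * (t - 1)) + (n\<^sup>2 - 6 * n + 16) * t"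
      by (simp add: algebra_simps power2_eq_square)
    ultimately show ?thesis by linarith
  qed
  moreover have "lam\<^sup>2 + lam / (4 * r\<^sup>2) + (n - 3)\<^sup>2 / (16 * r ^ 4)
    = lam\<^sup>2 + lam * t / 4 + (n\<^sup>2 - 6 * n + 16) * t\<^sup>2 / 16 - 7 / 16 * t\<^sup>2"
    unfolding t_def y_def using r by (simp add: field_simps power_numeral_reduce)
  ultimately show ?thesis unfolding eq by linarith
qed

text \<open>Right side minus left side is V times a sum of nonnegative terms: the square of lap + a
  U, the discarded tangential energy 2 a (G2 - ur^2), the two completed squares in ur, and the slack
  in the potential. The relation imposed on q makes the coefficients of U ur agree.\<close>

lemma pointwise_divergence_bound:
  fixes V lap T U a lam b n h r q q1 ur G2 a1 p1 p2 :: real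
  assumes "V > 0" "lam \<ge> 0" "b \<ge> 0" and a: "a = lam + b" and q: "q = - 2 * lam * p1 - 2 * b * p2 + a1"
    and T: "T \<le> - a\<^sup>2 - 2 * lam * p1\<^sup>2 - 2 * b * p2\<^sup>2 - q1 - n * h * q"
    and G2: "G2 \<ge> ur\<^sup>2" and r: "r \<noteq> 0"
  shows "- 2 * (a1 * U * V * ur + a * V * G2 + a * U * (V * lap)) + 2 * U * (q * V) * ur
      + U\<^sup>2 * (q1 * V + q * (V * (n * (h - 1 / r)))) + U\<^sup>2 * (q * V) * (n / r)
    \<le> V * lap\<^sup>2 - T * U\<^sup>2 * V"
proof -
  define E where "E = - a\<^sup>2 - 2 * lam * p1\<^sup>2 - 2 * b * p2\<^sup>2 - q1 - n * h * q"
  have "0 \<le> V * ((lap + a * U)\<^sup>2 + 2 * a * (G2 - ur\<^sup>2) + 2 * lam * (ur + p1 * U)\<^sup>2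
      + 2 * b * (ur + p2 * U)\<^sup>2 + (E - T) * U\<^sup>2)"
    using assms(1-3) a T G2 unfolding E_def[symmetric]
    by (intro mult_nonneg_nonneg add_nonneg_nonneg) auto
  also have "\<dots> = V * lap\<^sup>2 - T * U\<^sup>2 * V
      - (- 2 * (a1 * U * V * ur + a * V * G2 + a * U * (V * lap)) + 2 * U * (q * V) * ur
      + U\<^sup>2 * (q1 * V + q * V * n * h))"
    unfolding E_def a q by (simp add: algebra_simps power2_eq_square)
  \<comment> \<open>The Euclidean divergence n/r of the radial direction and the derivative of the
    density, n (h - 1/r), add up to n h, the Laplacian of r on the model.\<close>
  also have "U\<^sup>2 * (q1 * V + q * V * n * h)
      = U\<^sup>2 * (q1 * V + q * (V * (n * (h - 1 / r)))) + U\<^sup>2 * (q * V) * (n / r)"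
    by (simp add: algebra_simps)
  finally show ?thesis by linarith
qed

section \<open>Consequences of psi'' >= psi for the profile\<close>

locale model_profile =
  fixes psi :: "real \<Rightarrow> real" and D :: "nat \<Rightarrow> real \<Rightarrow> real"
  assumes D0: "D 0 = psi"
    and D_within: "x \<ge> 0 \<Longrightarrow> (D k has_real_derivative D (Suc k) x) (at x within {0..})"
    and pos: "x > 0 \<Longrightarrow> psi x > 0"
    and psi_0: "psi 0 = 0"
    and D1_0: "D 1 0 = 1"
    and D2_ge: "x > 0 \<Longrightarrow> D 2 x \<ge> psi x"
begin

lemma D_deriv: "x > 0 \<Longrightarrow> (D k has_real_derivative D (Suc k) x) (at x)"
  using D_within[of x k] at_within_interior[of x "{0..}"] by simp

lemma psi_deriv: "x > 0 \<Longrightarrow> (psi has_real_derivative D 1 x) (at x)"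
  using D_deriv[of x 0] by (simp add: D0)

lemma D1_deriv: "x > 0 \<Longrightarrow> (D 1 has_real_derivative D 2 x) (at x)"
  using D_deriv[of x 1] by (simp add: numeral_2_eq_2)

lemma D_continuous: "continuous_on {0..} (D k)"
  unfolding continuous_on_eq_continuous_within
  using D_within by (auto intro: DERIV_continuous)

lemma psi_continuous: "continuous_on {0..} psi"
  using D_continuous[of 0] by (simp add: D0)

lemma D1_mono:
  assumes "0 \<le> x" "x \<le> y"
  shows "D 1 x \<le> D 1 y"
proof (rule DERIV_nonneg_imp_increasing_open[where f="D 1"])
  fix z assume z: "x < z" "z < y"
  then have "z > 0" using assms by simp
  then show "\<exists>d. (D 1 has_real_derivative d) (at z) \<and> 0 \<le> d"
    using D1_deriv[of z] D2_ge[of z] pos[of z] by (intro exI[of _ "D 2 z"]) auto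
qed (use assms in \<open>auto intro: continuous_on_subset[OF D_continuous]\<close>)

lemma D1_ge_1: "x \<ge> 0 \<Longrightarrow> D 1 x \<ge> 1"
  using D1_mono[of 0 x] D1_0 by simp

lemma psi_ge:
  assumes "x \<ge> 0"
  shows "psi x \<ge> x"
proof -
  have "psi 0 - 0 \<le> psi x - x"
  proof (rule DERIV_nonneg_imp_increasing_open[OF assms])
    fix z :: real assume "0 < z" "z < x"
    then show "\<exists>d. ((\<lambda>x. psi x - x) has_real_derivative d) (at z) \<and> 0 \<le> d"
      using D1_ge_1[of z] by (intro exI[of _ "D 1 z - 1"]) (auto intro!: derivative_eq_intros psi_deriv)
  qed (auto intro!: continuous_intros continuous_on_subset[OF psi_continuous])
  then show ?thesis using psi_0 by simp
qed

text \<open>The derivative of x psi' - psi is x psi'', which is nonnegative. This yields h >=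
  1/r.\<close>

lemma psi_le:
  assumes "x \<ge> 0"
  shows "psi x \<le> x * D 1 x"
proof -
  have "0 * D 1 0 - psi 0 \<le> x * D 1 x - psi x"
  proof (rule DERIV_nonneg_imp_increasing_open[OF assms])
    fix z :: real assume z: "0 < z" "z < x"
    have "((\<lambda>x. x * D 1 x - psi x) has_real_derivative z * D 2 z) (at z)"
      using z by (auto intro!: derivative_eq_intros psi_deriv D1_deriv[unfolded One_nat_def])
    then show "\<exists>d. ((\<lambda>x. x * D 1 x - psi x) has_real_derivative d) (at z) \<and> 0 \<le> d"
      using z D2_ge[of z] pos[of z] by (intro exI[of _ "z * D 2 z"]) auto
  qed (auto intro!: continuous_intros continuous_on_subset[OF psi_continuous] continuous_on_subset[OF D_continuous])
  then show ?thesis using psi_0 by simp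
qed

text \<open>With the integrating factor e^x, the derivative of (psi' - psi) e^x is (psi'' - psi) e^x
  >= 0, and the value at 0 is 1. This yields h >= 1.\<close>

lemma psi_le_D1:
  assumes "x \<ge> 0"
  shows "psi x \<le> D 1 x"
proof -
  have "(D 1 0 - psi 0) * exp 0 \<le> (D 1 x - psi x) * exp x"
  proof (rule DERIV_nonneg_imp_increasing_open[OF assms])
    fix z :: real assume z: "0 < z" "z < x"
    have "((\<lambda>x. (D 1 x - psi x) * exp x) has_real_derivative (D 2 z - psi z) * exp z) (at z)"
      using z by (auto intro!: derivative_eq_intros psi_deriv D1_deriv[unfolded One_nat_def] simp: algebra_simps)
    then show "\<exists>d. ((\<lambda>x. (D 1 x - psi x) * exp x) has_real_derivative d) (at z) \<and> 0 \<le> d"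
      using z D2_ge[of z] by (intro exI[of _ "(D 2 z - psi z) * exp z"]) auto
  qed (auto intro!: continuous_intros continuous_on_subset[OF psi_continuous] continuous_on_subset[OF D_continuous])
  then have "0 \<le> (D 1 x - psi x) * exp x" using psi_0 D1_0 by simp
  then show ?thesis by (simp add: zero_le_mult_iff not_le[symmetric])
qed

definition h :: "real \<Rightarrow> real" where "h r = D 1 r / psi r"
text \<open>The derivative of \<open>h\<close> in Riccati form; psi'' >= psi therefore reads h' >= 1
  - h^2.\<close>

definition h1 :: "real \<Rightarrow> real" where "h1 r = D 2 r / psi r - (h r)\<^sup>2"

lemma h_bounds:
  assumes "r > 0"
  shows "h r \<ge> 1" "h r \<ge> 1 / r" "h1 r \<ge> 1 - (h r)\<^sup>2"
  using assms pos[of r] psi_le[of r] psi_le_D1[of r] D2_ge[of r]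
  by (auto simp: h_def h1_def field_simps)

lemma continuous_pos: "continuous_on {0<..} (D k)" "continuous_on {0<..} psi"
  by (rule continuous_on_subset[OF D_continuous] continuous_on_subset[OF psi_continuous]; auto)+

text \<open>Denominators are controlled by psi(r) >= r, the numerator psi' by its monotonicity, and
  psi'' by compactness of [0, R].\<close>

lemma rsing_h: "rsing 1 h h1"
  unfolding rsing_def
proof (intro conjI allI impI)
  fix r :: real assume r: "r > 0"
  show "(h has_real_derivative h1 r) (at r)"
    unfolding h_def[abs_def] h1_def using r pos[OF r]
    by (auto intro!: derivative_eq_intros psi_deriv D1_deriv[unfolded One_nat_def] simp: h_def field_simps power2_eq_square)
next
  show "continuous_on {0<..} h1"
    unfolding h1_def[abs_def] h_def using pos
    by (intro continuous_intros continuous_pos) force+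
next
  fix R :: real assume R: "R > 0"
  define M where "M = D 1 R"
  have "bounded (D 2 ` {0..R})"
    by (intro compact_imp_bounded compact_continuous_image continuous_on_subset[OF D_continuous]) auto
  then obtain B where "\<forall>y \<in> D 2 ` {0..R}. norm y \<le> B" unfolding bounded_iff by blast
  then have B: "\<bar>D 2 z\<bar> \<le> B" if "z \<in> {0..R}" for z using that by simp
  have B0: "B \<ge> 0" using B[of 0] R by auto
  have M1: "M \<ge> 1" using D1_ge_1[of R] R by (simp add: M_def)
  have "\<bar>h r\<bar> \<le> (M + B * R + M\<^sup>2) / r ^ 1 \<and> \<bar>h1 r\<bar> \<le> (M + B * R + M\<^sup>2) / r ^ Suc 1" if r: "0 < r" "r \<le> R" for r
  proof -
    have "\<bar>h r\<bar> = D 1 r / psi r" using D1_ge_1[of r] pos[of r] r by (simp add: h_def)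
    also have "\<dots> \<le> M / r"
      using D1_mono[of r R] D1_ge_1[of r] psi_ge[of r] r by (intro frac_le) (auto simp: M_def)
    finally have hM: "\<bar>h r\<bar> \<le> M / r" .
    have "\<bar>D 2 r / psi r\<bar> = \<bar>D 2 r\<bar> / psi r" using pos[of r] r by simp
    also have "\<dots> \<le> B / r" using B[of r] psi_ge[of r] r by (intro frac_le) auto
    \<comment> \<open>One power of r is given away, since the term h^2 is of order 2 in any
      case.\<close>
    also have "\<dots> \<le> B * R / r\<^sup>2" using r B0 by (simp add: field_simps power2_eq_square mult_left_mono)
    finally have "\<bar>D 2 r / psi r\<bar> \<le> B * R / r\<^sup>2" .
    moreover have "(h r)\<^sup>2 \<le> M\<^sup>2 / r\<^sup>2" using power_mono[OF hM, of 2] by (simp add: power_divide)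
    ultimately have "\<bar>h1 r\<bar> \<le> B * R / r\<^sup>2 + M\<^sup>2 / r\<^sup>2" using zero_le_power2[of "h r"] unfolding h1_def by linarith
    also have "\<dots> \<le> (M + B * R + M\<^sup>2) / r\<^sup>2" using M1 by (simp add: add_divide_distrib)
    finally have "\<bar>h1 r\<bar> \<le> (M + B * R + M\<^sup>2) / r\<^sup>2" .
    moreover have "M / r \<le> (M + B * R + M\<^sup>2) / r" using r M1 B0 R by (intro divide_right_mono) auto
    ultimately show ?thesis using hM by (simp add: power2_eq_square)
  qed
  then show "\<exists>C. \<forall>r. 0 < r \<longrightarrow> r \<le> R \<longrightarrow> \<bar>h r\<bar> \<le> C / r ^ 1 \<and> \<bar>h1 r\<bar> \<le> C / r ^ Suc 1" by blast
qed

lemma rsing_psi_over: "rsing 0 (\<lambda>r. psi r / r) (\<lambda>r. psi r / r * (h r - 1 / r))"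
  unfolding rsing_def
proof (intro conjI allI impI)
  fix r :: real assume r: "r > 0"
  show "((\<lambda>r. psi r / r) has_real_derivative psi r / r * (h r - 1 / r)) (at r)"
    using r pos[OF r]
    by (auto intro!: derivative_eq_intros psi_deriv simp: h_def field_simps power2_eq_square)
next
  show "continuous_on {0<..} (\<lambda>r. psi r / r * (h r - 1 / r))"
    unfolding h_def using pos by (intro continuous_intros continuous_pos) force+
next
  fix R :: real assume R: "R > 0"
  define M where "M = D 1 R"
  have "\<bar>psi r / r\<bar> \<le> M / r ^ 0 \<and> \<bar>psi r / r * (h r - 1 / r)\<bar> \<le> M / r ^ Suc 0" if r: "0 < r" "r \<le> R" for r
  proof -
    have M: "D 1 r \<le> M" using D1_mono[of r R] r by (simp add: M_def)
    have "psi r \<le> r * D 1 r" using psi_le[of r] r by simp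
    also have "\<dots> \<le> r * M" using M r by (intro mult_left_mono) auto
    finally have "\<bar>psi r / r\<bar> \<le> M" using r pos[of r] by (simp add: field_simps)
    moreover have "psi r / r * (h r - 1 / r) = D 1 r / r - psi r / r\<^sup>2"
      using r pos[of r] by (simp add: h_def field_simps power2_eq_square)
    \<comment> \<open>Because h >= 1/r, the derivative psi'/r - psi/r^2 is nonnegative, so its
      absolute value is bounded by the positive part psi'/r alone.\<close>
    moreover have "0 \<le> psi r / r * (h r - 1 / r)" using h_bounds(2)[of r] r pos[of r] by (intro mult_nonneg_nonneg) auto
    moreover have "D 1 r / r \<le> M / r" "0 \<le> psi r / r\<^sup>2" using M r pos[of r] by (auto simp: divide_right_mono)
    ultimately show ?thesis by simp
  qed
  then show "\<exists>C. \<forall>r. 0 < r \<longrightarrow> r \<le> R \<longrightarrow> \<bar>psi r / r\<bar> \<le> C / r ^ 0 \<and> \<bar>psi r / r * (h r - 1 / r)\<bar> \<le> C / r ^ Suc 0" by blast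
qed

text \<open>The bound psi(r) >= r gives r/psi <= 1, and 0 <= h - 1/r <= h transfers the bound
  already known for h.\<close>

lemma rsing_over_psi: "rsing 0 (\<lambda>r. r / psi r) (\<lambda>r. - (r / psi r * (h r - 1 / r)))"
  unfolding rsing_def
proof (intro conjI allI impI)
  fix r :: real assume r: "r > 0"
  show "((\<lambda>r. r / psi r) has_real_derivative - (r / psi r * (h r - 1 / r))) (at r)"
    using r pos[OF r]
    by (auto intro!: derivative_eq_intros psi_deriv simp: h_def field_simps power2_eq_square)
next
  show "continuous_on {0<..} (\<lambda>r. - (r / psi r * (h r - 1 / r)))"
    unfolding h_def using pos by (intro continuous_intros continuous_pos) force+
next
  fix R :: real assume R: "R > 0"
  obtain C where C: "C \<ge> 0" "\<And>r. 0 < r \<Longrightarrow> r \<le> R \<Longrightarrow> \<bar>h r\<bar> \<le> C / r ^ 1"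
    "\<And>r. 0 < r \<Longrightarrow> r \<le> R \<Longrightarrow> \<bar>h1 r\<bar> \<le> C / r ^ Suc 1"
    by (rule rsing_bound[OF rsing_h R]) (rule that)
  have "\<bar>r / psi r\<bar> \<le> (1 + C) / r ^ 0 \<and> \<bar>- (r / psi r * (h r - 1 / r))\<bar> \<le> (1 + C) / r ^ Suc 0" if r: "0 < r" "r \<le> R" for r
  proof -
    have 1: "\<bar>r / psi r\<bar> \<le> 1" using r pos[of r] psi_ge[of r] by simp
    have "1 / r > 0" using r by simp
    then have "\<bar>h r - 1 / r\<bar> \<le> C / r" using C(2)[OF r] h_bounds(2)[of r] r
      unfolding power_one_right by linarith
    then have "\<bar>r / psi r * (h r - 1 / r)\<bar> \<le> 1 * (C / r)"
      unfolding abs_mult using 1 by (intro mult_mono) auto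
    also have "\<dots> \<le> (1 + C) / r" using r by (simp add: divide_right_mono)
    finally show ?thesis using 1 C(1) by simp
  qed
  then show "\<exists>C. \<forall>r. 0 < r \<longrightarrow> r \<le> R \<longrightarrow> \<bar>r / psi r\<bar> \<le> C / r ^ 0 \<and> \<bar>- (r / psi r * (h r - 1 / r))\<bar> \<le> C / r ^ Suc 0" by blast
qed

text \<open>Stated through the logarithmic derivative, so that the density factors out of every
  later product rule.\<close>

lemma rsing_voldens: "rsing 0 (\<lambda>r. (psi r / r) ^ m) (\<lambda>r. (psi r / r) ^ m * (real m * (h r - 1 / r)))"
  using rsing_power[OF rsing_psi_over, of m] by (rule rsing_cong) (cases m; simp)+

end

section \<open>The Poincare-Rellich inequality\<close>

text \<open>The derivative is left existential: for the flux only its order matters, and its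
  diagonal sum is identified with the Laplacian through \<open>pdir\<close>.\<close>

lemma sing1_mult0: "sing1 0 f f' \<Longrightarrow> sing1 0 g g' \<Longrightarrow> \<exists>k'. sing1 0 (\<lambda>x. f x * g x) k'"
  using sing1_mult[of 0 f f' 0 g g'] by auto

lemma smooth_fn_sing1:
  assumes "smooth_fn f"
  shows "sing1 0 f (\<lambda>i. pdir i f)" "smooth_fn (pdir i f)"
proof -
  have d: "f differentiable_on UNIV" and sm: "\<And>i. smooth_fn (pdir i f)"
    using assms by (auto elim: smooth_fn.cases)
  show "smooth_fn (pdir i f)" by (rule sm)
  have c: "continuous_on UNIV g" if "smooth_fn g" for g :: "real^'a \<Rightarrow> real"
    using that by (auto elim!: smooth_fn.cases intro: differentiable_imp_continuous_on)
  have "has_pd f i (pdir i f x) x" for i x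
  proof -
    have "f differentiable (at (x + 0 *\<^sub>R axis i 1))"
      using d by (simp add: differentiable_on_def)
    moreover have "(\<lambda>t::real. x + t *\<^sub>R axis i 1) differentiable (at 0)"
      by (auto intro!: derivative_eq_intros simp: differentiable_def)
    ultimately have "(f \<circ> (\<lambda>t. x + t *\<^sub>R axis i 1)) differentiable (at (0::real))"
      by (intro differentiable_chain_at) auto
    then show ?thesis
      unfolding has_pd_def pdir_def by (simp add: DERIV_deriv_iff_real_differentiable o_def)
  qed
  moreover have "sing (Suc 0) (pdir i f)" for i
    using sing_mono[OF sing_continuous[OF c[OF sm[of i]]], of "Suc 0"] by simp
  ultimately show "sing1 0 f (\<lambda>i. pdir i f)"
    using sing_continuous[OF c[OF assms]] by (simp add: sing1_def)
qed

text \<open>A polynomial in r/psi(r) and the direction cosines, all of order 0, so the product rules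
  apply directly. With division by zero equal to 0 it also holds at the origin.\<close>

lemma ginv_eq:
  "ginv psi i j x = (norm x / psi (norm x)) * (norm x / psi (norm x)) *
     ((if i = j then 1 else 0) + (-1) * (x $ i / norm x * (x $ j / norm x))) + x $ i / norm x * (x $ j / norm x)"
  by (simp add: ginv_def power2_eq_square)

lemma sum_dir_squares: "x \<noteq> 0 \<Longrightarrow> (\<Sum>i\<in>UNIV. (x $ i / norm x) * (x $ i / norm x)) = 1"
  for x :: "real^'n::finite"
proof -
  assume x: "x \<noteq> 0"
  have "(\<Sum>i\<in>UNIV. x $ i * x $ i) = norm x * norm x"
    using power2_norm_eq_inner[of x] by (simp add: inner_vec_def power2_eq_square)
  then show ?thesis using x by (simp flip: sum_divide_distrib)
qed

section \<open>The flux of u, the vector field and the integrated inequality\<close>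

context model_profile
begin

lemma sing1_ginv: "\<exists>G'. sing1 0 (ginv psi i j :: real^'n::finite \<Rightarrow> real) G'"
proof -
  note w = sing1_dir
  obtain A where A: "sing1 0 (\<lambda>x::real^'n. x $ i / norm x * (x $ j / norm x)) A"
    using sing1_mult0[OF w w] by blast
  obtain B where B: "sing1 0 (\<lambda>x::real^'n. norm x / psi (norm x) * (norm x / psi (norm x))) B"
    using sing1_mult0[OF rsing_sing1[OF rsing_over_psi] rsing_sing1[OF rsing_over_psi]] by blast
  have "\<exists>C. sing1 0 (\<lambda>x::real^'n. (norm x / psi (norm x) * (norm x / psi (norm x))) *
      ((if i = j then 1 else 0) + (-1) * (x $ i / norm x * (x $ j / norm x)))) C"
    by (rule sing1_mult0[OF B sing1_add[OF sing1_const sing1_cmult[OF A]]])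
  then show ?thesis
    unfolding ginv_eq[abs_def] using sing1_add[OF _ A] by blast
qed

lemma flux_sing1:
  fixes u :: "real^'n::finite \<Rightarrow> real"
  assumes "smooth_fn u"
  shows "\<exists>W'. sing1 0 (\<lambda>y. voldens psi y * (\<Sum>j\<in>UNIV. ginv psi i j y * pdir j u y)) W'"
proof -
  have "\<exists>G'. sing1 0 (\<lambda>y. ginv psi i j y * pdir j u y) G'" for j
    using sing1_ginv[of i j] smooth_fn_sing1(1)[OF smooth_fn_sing1(2)[OF assms]] sing1_mult0 by blast
  then obtain G where "\<And>j. sing1 0 (\<lambda>y. ginv psi i j y * pdir j u y) (G j)" by metis
  then have "sing1 0 (\<lambda>y. \<Sum>j\<in>UNIV. ginv psi i j y * pdir j u y) (\<lambda>l y. \<Sum>j\<in>UNIV. G j l y)"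
    by (intro sing1_sum) auto
  then show ?thesis
    unfolding voldens_def using sing1_mult0[OF rsing_sing1[OF rsing_voldens]] by blast
qed

lemma poincare_rellich:
  fixes u :: "real^'n::finite \<Rightarrow> real"
  assumes N5: "CARD('n) \<ge> 5" and smooth: "smooth_fn u" and supp: "bounded {x. u x \<noteq> 0}"
  shows "(LINT x|lborel. (lap_g psi u x)^2 * voldens psi x)
           - ((real CARD('n) - 1) / 2)^4 * (LINT x|lborel. (u x)^2 * voldens psi x)
         \<ge> (real CARD('n) - 4)^2 / 16 * (LINT x|lborel. (u x)^2 / (norm x)^4 * voldens psi x)
           + (real CARD('n) - 1)^2 / 16 * (LINT x|lborel. (u x)^2 / (norm x)^2 * voldens psi x)"
proof -
  define m where "m = CARD('n) - 1"
  define n where "n = real m"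
  have n: "n \<ge> 4" and nN: "real CARD('n) = n + 1" using N5 by (auto simp: n_def m_def of_nat_diff)
  define lam where "lam = n\<^sup>2 / 4"
  define a where "a r = lam + 1 / (4 * r\<^sup>2)" for r :: real
  define a1 where "a1 r = - 1 / (2 * r ^ 3)" for r :: real
  \<comment> \<open>The expansion of -2 lam p1 - 2 b p2 + a' with b = 1/(4 r^2); \<open>q1\<close>
    is its derivative.\<close>
  define q where "q r = - lam * n * h r + lam / r - n * h r / (4 * r\<^sup>2) + 1 / (4 * r ^ 3)" for r
  define q1 where "q1 r = - lam * n * h1 r - lam / r\<^sup>2 - n * h1 r / (4 * r\<^sup>2) + n * h r / (2 * r ^ 3) - 3 / (4 * r ^ 4)" for r
  define V where "V r = (psi r / r) ^ m" for r
  define V1 where "V1 r = V r * (n * (h r - 1 / r))" for r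
  have V: "rsing 0 V V1"
    using rsing_voldens[of m] by (rule rsing_cong) (auto simp: V_def V1_def n_def)
  have Vpos: "V r > 0" if "r > 0" for r using pos[OF that] that by (simp add: V_def)
  have vd: "voldens psi x = V (norm x)" for x :: "real^'n" by (simp add: voldens_def V_def m_def)
  have inv2: "rsing 2 (\<lambda>r. 1 / r * (1 / r)) (\<lambda>r. - 1 / r\<^sup>2 * (1 / r) + 1 / r * (- 1 / r\<^sup>2))"
    using rsing_mult[OF rsing_inverse rsing_inverse] by (simp add: numeral_2_eq_2)
  have inv3: "rsing 3 (\<lambda>r. 1 / r * (1 / r) * (1 / r))
      (\<lambda>r. (- 1 / r\<^sup>2 * (1 / r) + 1 / r * (- 1 / r\<^sup>2)) * (1 / r) + 1 / r * (1 / r) * (- 1 / r\<^sup>2))"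
    using rsing_mult[OF inv2 rsing_inverse] by (simp add: numeral_3_eq_3)
  have a: "rsing 2 a a1"
    using rsing_add[OF rsing_mono[OF rsing_const[of lam]] rsing_cmult[OF inv2, of "1/4"]]
    by (rule rsing_cong) (auto simp: a_def a1_def power_numeral_reduce field_simps)
  have hinv2: "rsing 3 (\<lambda>r. h r * (1 / r * (1 / r))) (\<lambda>r. h1 r * (1 / r * (1 / r)) + h r * (- 1 / r\<^sup>2 * (1 / r) + 1 / r * (- 1 / r\<^sup>2)))"
    using rsing_mult[OF rsing_h inv2] by (simp add: numeral_3_eq_3)
  have "rsing 3 (\<lambda>r. - lam * n * h r + lam * (1 / r) + (- n / 4) * (h r * (1 / r * (1 / r))) + 1/4 * (1 / r * (1 / r) * (1 / r)))
    (\<lambda>r. - lam * n * h1 r + lam * (- 1 / r\<^sup>2) + (- n / 4) * (h1 r * (1 / r * (1 / r)) + h r * (- 1 / r\<^sup>2 * (1 / r) + 1 / r * (- 1 / r\<^sup>2)))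
      + 1/4 * ((- 1 / r\<^sup>2 * (1 / r) + 1 / r * (- 1 / r\<^sup>2)) * (1 / r) + 1 / r * (1 / r) * (- 1 / r\<^sup>2)))"
    by (intro rsing_add rsing_cmult hinv2 inv3 rsing_mono[OF rsing_h] rsing_mono[OF rsing_inverse]) auto
  then have q: "rsing 3 q q1"
    by (rule rsing_cong) (auto simp: q_def q1_def power_numeral_reduce field_simps)
  have qV: "rsing 3 (\<lambda>r. q r * V r) (\<lambda>r. q1 r * V r + q r * V1 r)"
    using rsing_mult[OF q V] by simp

  define W where "W i y = voldens psi y * (\<Sum>j\<in>UNIV. ginv psi i j y * pdir j u y)" for i and y :: "real^'n"
  have "\<exists>P. sing1 0 (W i) P" for i
    unfolding W_def[abs_def] by (rule flux_sing1[OF smooth])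
  then obtain P where P: "\<And>i. sing1 0 (W i) (P i)" by metis
  \<comment> \<open>The Euclidean divergence of the flux, equal to V times the Laplacian of u away
    from the pole.\<close>
  define L where "L x = (\<Sum>i\<in>UNIV. P i i x)" for x
  have lap: "lap_g psi u x = L x / V (norm x)" if "x \<noteq> 0" for x
    unfolding lap_g_def L_def vd[symmetric] W_def[symmetric] using sing1_imp_pdir[OF P that] by simp
  have u1: "sing1 0 u (\<lambda>i. pdir i u)" by (rule smooth_fn_sing1(1)[OF smooth])
  obtain R where R: "R > 0" "\<And>x. norm x > R \<Longrightarrow> u x = 0"
    using supp[unfolded bounded_pos] by fastforce
  have ne0: "x \<noteq> 0" if "norm x > R" for x :: "real^'n" using that R(1) by auto
  have du0: "pdir i u x = 0" if "norm x > R" for i x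
    using sing1_eq_0[OF u1 R(2) that ne0[OF that]] .
  have W0: "W i x = 0" if "norm x > R" for i x using du0[OF that] by (simp add: W_def)
  have L0: "L x = 0" if "norm x > R" for x
    using sing1_eq_0[OF P W0 that ne0[OF that]] by (simp add: L_def)

  \<comment> \<open>The term -2 a u grad u carries out the integration by parts, and the radial term
    u^2 q produces the completed squares. The density V is included, so Euclidean divergence and
    Lebesgue measure suffice. The factor q makes the order 3.\<close>
  define F where "F i x = (- 2) * (a (norm x) * u x * W i x)
      + u x * u x * (q (norm x) * V (norm x)) * (x $ i / norm x)" for i x
  define F' where "F' i l x = (- 2) * ((a1 (norm x) * (x $ l / norm x) * u x + a (norm x) * pdir l u x) * W i x
        + a (norm x) * u x * P i l x)
      + (((pdir l u x * u x + u x * pdir l u x) * (q (norm x) * V (norm x))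
          + u x * u x * ((q1 (norm x) * V (norm x) + q (norm x) * V1 (norm x)) * (x $ l / norm x))) * (x $ i / norm x)
        + u x * u x * (q (norm x) * V (norm x)) *
          (((if l = i then 1 else 0) - (x $ l / norm x) * (x $ i / norm x)) / norm x))" for i l x
  have F: "sing1 3 (F i) (F' i)" for i
  proof -
    have "sing1 2 (\<lambda>x. a (norm x) * u x * W i x)
        (\<lambda>l x. (a1 (norm x) * (x $ l / norm x) * u x + a (norm x) * pdir l u x) * W i x + a (norm x) * u x * P i l x)"
      using sing1_mult[OF sing1_mult[OF rsing_sing1[OF a] u1] P] by simp
    from sing1_cmult[OF sing1_mono[OF this, of 3], of "- 2"]
    have 1: "sing1 3 (\<lambda>x. (- 2) * (a (norm x) * u x * W i x))
      (\<lambda>l x. (- 2) * ((a1 (norm x) * (x $ l / norm x) * u x + a (norm x) * pdir l u x) * W i x + a (norm x) * u x * P i l x))"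
      by simp
    have 2: "sing1 3 (\<lambda>x. u x * u x * (q (norm x) * V (norm x)) * (x $ i / norm x))
      (\<lambda>l x. ((pdir l u x * u x + u x * pdir l u x) * (q (norm x) * V (norm x))
          + u x * u x * ((q1 (norm x) * V (norm x) + q (norm x) * V1 (norm x)) * (x $ l / norm x))) * (x $ i / norm x)
        + u x * u x * (q (norm x) * V (norm x)) *
          (((if l = i then 1 else 0) - (x $ l / norm x) * (x $ i / norm x)) / norm x))"
      using sing1_mult[OF sing1_mult[OF sing1_mult[OF u1 u1] rsing_sing1[OF qV]] sing1_dir] by simp
    show ?thesis unfolding F_def[abs_def] F'_def[abs_def] by (rule sing1_add[OF 1 2])
  qed
  have F0: "F i x = 0" if "norm x > R" for i x using R(2)[OF that] by (simp add: F_def)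
  define dF where "dF x = (\<Sum>i\<in>UNIV. F' i i x)" for x
  have dF_int: "integrable lborel dF" and dF_0: "integral\<^sup>L lborel dF = 0"
    unfolding dF_def[abs_def] using integral_sing1_partial_eq_0[OF N5 F F0] by auto

  define T where "T r = lam\<^sup>2 + lam / (4 * r\<^sup>2) + (n - 3)\<^sup>2 / (16 * r ^ 4)" for r :: real
  have pw: "dF x \<le> V (norm x) * (lap_g psi u x)\<^sup>2 - T (norm x) * (u x)\<^sup>2 * V (norm x)" if x: "x \<noteq> 0" for x
  proof -
    define r where "r = norm x"
    have r: "r > 0" using x by (simp add: r_def)
    define w where "w i = x $ i / r" for i
    define d where "d i = pdir i u x" for i
    define ur where "ur = (\<Sum>i\<in>UNIV. w i * d i)"
    \<comment> \<open>The eigenvalue of the inverse metric on tangential directions; radially it is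
      1. Hence \<open>G2\<close> is the squared Riemannian length of the gradient.\<close>
    define s where "s = (r / psi r)\<^sup>2"
    define G2 where "G2 = s * ((\<Sum>i\<in>UNIV. d i * d i) - ur\<^sup>2) + ur\<^sup>2"
    have ww: "(\<Sum>i\<in>UNIV. w i * w i) = 1" unfolding w_def r_def by (rule sum_dir_squares[OF x])
    have ww1: "(\<Sum>i\<in>UNIV. 1 - w i * w i) = real CARD('n) - 1" by (simp add: sum_subtractf ww)
    have g: "ginv psi i j x = s * ((if i = j then 1 else 0) - w i * w j) + w i * w j" for i j
      by (simp add: ginv_def s_def w_def r_def power2_eq_square)
    have W: "W i x = V r * (s * (d i - w i * ur) + w i * ur)" for i
    proof -
      have "(\<Sum>j\<in>UNIV. ginv psi i j x * d j) = (\<Sum>j\<in>UNIV. s * ((if i = j then d j else 0) - w i * (w j * d j)) + w i * (w j * d j))"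
        unfolding g by (intro sum.cong) (auto simp: algebra_simps)
      also have "\<dots> = s * (d i - w i * ur) + w i * ur"
        by (simp add: sum.distrib sum_subtractf sum.delta ur_def flip: sum_distrib_left)
      finally show ?thesis by (simp add: W_def vd d_def r_def)
    qed
    \<comment> \<open>The factor \<open>s\<close> disappears because the inverse metric fixes the
      radial direction: the radial flux is V u_r.\<close>
    have wW: "(\<Sum>i\<in>UNIV. w i * W i x) = V r * ur"
    proof -
      have "(\<Sum>i\<in>UNIV. w i * W i x) = (\<Sum>i\<in>UNIV. V r * (s * (w i * d i) + (1 - s) * ur * (w i * w i)))"
        unfolding W by (intro sum.cong) (auto simp: algebra_simps)
      also have "\<dots> = V r * (s * ur + (1 - s) * ur)"
        by (simp add: sum.distrib ur_def[symmetric] ww flip: sum_distrib_left)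
      also have "\<dots> = V r * ur" by (simp add: algebra_simps)
      finally show ?thesis .
    qed
    have dW: "(\<Sum>i\<in>UNIV. d i * W i x) = V r * G2"
    proof -
      have "(\<Sum>i\<in>UNIV. d i * W i x) = (\<Sum>i\<in>UNIV. V r * (s * (d i * d i) + (1 - s) * ur * (w i * d i)))"
        unfolding W by (intro sum.cong) (auto simp: algebra_simps)
      also have "\<dots> = V r * (s * (\<Sum>i\<in>UNIV. d i * d i) + (1 - s) * ur * ur)"
        by (simp add: sum.distrib ur_def[symmetric] flip: sum_distrib_left)
      also have "\<dots> = V r * G2" by (simp add: G2_def algebra_simps power2_eq_square)
      finally show ?thesis .
    qed
    \<comment> \<open>The tangential part of the Euclidean gradient has nonnegative squared length;
      since s >= 0, the Riemannian gradient also dominates u_r.\<close>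
    have "0 \<le> (\<Sum>i\<in>UNIV. (d i - ur * w i)\<^sup>2)" by (intro sum_nonneg) auto
    also have "\<dots> = (\<Sum>i\<in>UNIV. d i * d i - 2 * ur * (w i * d i) + ur\<^sup>2 * (w i * w i))"
      by (intro sum.cong) (auto simp: algebra_simps power2_eq_square)
    also have "\<dots> = (\<Sum>i\<in>UNIV. d i * d i) - 2 * ur * ur + ur\<^sup>2 * 1"
      by (simp add: sum.distrib sum_subtractf ur_def[symmetric] ww flip: sum_distrib_left)
    finally have "ur\<^sup>2 \<le> (\<Sum>i\<in>UNIV. d i * d i)" by (simp add: power2_eq_square)
    then have G2: "G2 \<ge> ur\<^sup>2" by (simp add: G2_def s_def)
    \<comment> \<open>Only the diagonal derivatives l = i enter. They are grouped so that each sum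
      over i is one of those computed above.\<close>
    have "dF x = (\<Sum>i\<in>UNIV. - 2 * (a1 r * u x * (w i * W i x) + a r * (d i * W i x) + a r * u x * P i i x)
        + 2 * u x * (q r * V r) * (w i * d i) + (u x)\<^sup>2 * (q1 r * V r + q r * V1 r) * (w i * w i)
        + (u x)\<^sup>2 * (q r * V r) / r * (1 - w i * w i))"
      unfolding dF_def F'_def r_def[symmetric] w_def[symmetric] d_def[symmetric]
      by (intro sum.cong) (simp_all add: algebra_simps power2_eq_square diff_divide_distrib)
    also have "\<dots> = - 2 * (a1 r * u x * (V r * ur) + a r * (V r * G2) + a r * u x * L x)
        + 2 * u x * (q r * V r) * ur + (u x)\<^sup>2 * (q1 r * V r + q r * V1 r) * 1
        + (u x)\<^sup>2 * (q r * V r) / r * (real CARD('n) - 1)"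
      unfolding L_def wW[symmetric] dW[symmetric]
      by (simp only: sum.distrib sum_distrib_left[symmetric] ur_def[symmetric] ww ww1)
    also have "\<dots> = - 2 * (a1 r * u x * V r * ur + a r * V r * G2 + a r * u x * (V r * lap_g psi u x))
        + 2 * u x * (q r * V r) * ur + (u x)\<^sup>2 * (q1 r * V r + q r * (V r * (n * (h r - 1 / r))))
        + (u x)\<^sup>2 * (q r * V r) * (n / r)"
      using Vpos[OF r] by (simp add: lap[OF x] nN V1_def r_def)
    also have "\<dots> \<le> V r * (lap_g psi u x)\<^sup>2 - T r * (u x)\<^sup>2 * V r"
    proof (rule pointwise_divergence_bound[OF Vpos[OF r]])
      show "q r = - 2 * lam * (n * h r / 2 - 1 / (2 * r)) - 2 * (1 / (4 * r\<^sup>2)) * (n * h r / 2 - 3 / (2 * r)) + a1 r"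
        using r by (simp add: q_def a1_def field_simps power_numeral_reduce)
      show "T r \<le> - (a r)\<^sup>2 - 2 * lam * (n * h r / 2 - 1 / (2 * r))\<^sup>2 - 2 * (1 / (4 * r\<^sup>2)) * (n * h r / 2 - 3 / (2 * r))\<^sup>2 - q1 r - n * h r * q r"
        unfolding T_def a_def q_def q1_def lam_def
        by (rule radial_potential_lower_bound[OF n r h_bounds[OF r]])
    qed (use r G2 in \<open>auto simp: a_def lam_def\<close>)
    finally show ?thesis by (simp add: r_def)
  qed

  have sV: "sing 0 (\<lambda>x::real^'n. V (norm x))" by (rule sing1_imp_sing[OF rsing_sing1[OF V]])
  have su: "sing 0 u" by (rule sing1_imp_sing[OF u1])
  have suuV: "sing 0 (\<lambda>x. (u x)\<^sup>2 * voldens psi x)"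
    using sing_mult[OF sing_mult[OF su su] sV] by (simp add: vd power2_eq_square)
  have s_inv: "sing k (\<lambda>x::real^'n. 1 / norm x ^ k)" for k
    by (rule singI) (auto intro!: continuous_intros exI[of _ 1])
  have int_k: "integrable lborel (\<lambda>x. (u x)\<^sup>2 / norm x ^ k * voldens psi x)" if "k \<le> 4" for k
  proof (rule sing_integrable)
    show "sing k (\<lambda>x. (u x)\<^sup>2 / norm x ^ k * voldens psi x)"
      using sing_mult[OF s_inv suuV, of k] by (simp add: mult_ac)
    show "k < CARD('n)" using that N5 by simp
  qed (use R in auto)
  have int_l: "integrable lborel (\<lambda>x. (lap_g psi u x)\<^sup>2 * voldens psi x)"
  proof (rule sing_integrable)
    \<comment> \<open>The integrand equals L^2/V away from the pole, and 1/V = (r/psi)^m is of order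
      0, so the total order is 2.\<close>
    have "sing 1 L" unfolding L_def[abs_def] using P by (intro sing_sum) (auto simp: sing1_def)
    moreover have "sing 0 (\<lambda>x::real^'n. (norm x / psi (norm x)) ^ m)"
      by (rule sing1_imp_sing[OF rsing_sing1[OF rsing_power[OF rsing_over_psi]]])
    ultimately have "sing 2 (\<lambda>x. L x * L x * (norm x / psi (norm x)) ^ m)"
      using sing_mult[OF sing_mult] by (metis add_0_right one_add_one)
    then show "sing 2 (\<lambda>x. (lap_g psi u x)\<^sup>2 * voldens psi x)"
    proof (rule sing_cong)
      fix x :: "real^'n" assume x: "x \<noteq> 0"
      have "(norm x / psi (norm x)) ^ m = 1 / V (norm x)" by (simp add: V_def power_divide)
      then show "L x * L x * (norm x / psi (norm x)) ^ m = (lap_g psi u x)\<^sup>2 * voldens psi x"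
        using Vpos[of "norm x"] x by (simp add: lap vd field_simps power2_eq_square)
    qed
    show "2 < CARD('n)" using N5 by simp
    show "(lap_g psi u x)\<^sup>2 * voldens psi x = 0" if "norm x > R" for x
      using lap[OF ne0[OF that]] L0[OF that] by simp
  qed
  define K where "K k x = (u x)\<^sup>2 / norm x ^ k * voldens psi x" for k x
  have int_K: "integrable lborel (K k)" if "k \<le> 4" for k
    unfolding K_def[abs_def] by (rule int_k[OF that])
  have "integral\<^sup>L lborel dF \<le> (LINT x|lborel. (lap_g psi u x)\<^sup>2 * voldens psi x
      - (lam\<^sup>2 * K 0 x + lam / 4 * K 2 x
         + (n - 3)\<^sup>2 / 16 * K 4 x))"
  proof (rule integral_mono_AE[OF dF_int])
    \<comment> \<open>The pointwise inequality is available only away from the pole, which is a null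
      set.\<close>
    show "AE x in lborel. dF x \<le> (lap_g psi u x)\<^sup>2 * voldens psi x
      - (lam\<^sup>2 * K 0 x + lam / 4 * K 2 x
         + (n - 3)\<^sup>2 / 16 * K 4 x)"
      using AE_lborel_singleton[of 0]
    proof eventually_elim
      case (elim x)
      have "T (norm x) * (u x)\<^sup>2 * V (norm x) = lam\<^sup>2 * K 0 x
          + lam / 4 * K 2 x + (n - 3)\<^sup>2 / 16 * K 4 x"
        by (simp add: K_def T_def vd algebra_simps)
      then show ?case using pw[OF elim] by (simp add: vd mult.commute)
    qed
  qed (intro Bochner_Integration.integrable_diff Bochner_Integration.integrable_add integrable_mult_right int_l int_K; simp)
  also have "\<dots> = (LINT x|lborel. (lap_g psi u x)\<^sup>2 * voldens psi x)
      - (lam\<^sup>2 * integral\<^sup>L lborel (K 0) + lam / 4 * integral\<^sup>L lborel (K 2) + (n - 3)\<^sup>2 / 16 * integral\<^sup>L lborel (K 4))"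
    by (simp add: int_l int_K)
  finally have "lam\<^sup>2 * integral\<^sup>L lborel (K 0) + lam / 4 * integral\<^sup>L lborel (K 2) + (n - 3)\<^sup>2 / 16 * integral\<^sup>L lborel (K 4)
      \<le> (LINT x|lborel. (lap_g psi u x)\<^sup>2 * voldens psi x)"
    unfolding dF_0 by simp
  moreover have "lam\<^sup>2 = ((real CARD('n) - 1) / 2) ^ 4" "lam / 4 = (real CARD('n) - 1)\<^sup>2 / 16"
      "(n - 3)\<^sup>2 = (real CARD('n) - 4)\<^sup>2"
    by (simp_all add: lam_def nN power_divide flip: power_mult)
  moreover have "integral\<^sup>L lborel (K 0) = (LINT x|lborel. (u x)\<^sup>2 * voldens psi x)"
    "integral\<^sup>L lborel (K 2) = (LINT x|lborel. (u x)\<^sup>2 / (norm x)\<^sup>2 * voldens psi x)"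
    "integral\<^sup>L lborel (K 4) = (LINT x|lborel. (u x)\<^sup>2 / norm x ^ 4 * voldens psi x)"
    by (simp_all add: K_def[abs_def])
  ultimately show ?thesis by simp
qed

end

theorem theorem2p9:
  fixes psi :: "real \<Rightarrow> real" and D :: "nat \<Rightarrow> real \<Rightarrow> real"
    and u :: "real^'n::finite \<Rightarrow> real"
  assumes N5: "CARD('n) \<ge> 5"
    and D0: "D 0 = psi"
    and Dder: "\<forall>k x. x \<ge> 0 \<longrightarrow> (D k has_real_derivative D (Suc k) x) (at x within {0..})"
    and nonneg: "\<forall>x\<ge>0. psi x \<ge> 0"
    and pos: "\<forall>x>0. psi x > 0"
    and d1: "D 1 0 = 1"
    and even: "\<forall>k. D (2*k) 0 = 0"
    and Krad: "\<forall>r>0. - D 2 r / psi r \<le> -1"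
    and KH: "\<forall>r>0. - D 2 r / psi r \<ge> - ((D 1 r)^2 - 1) / (psi r)^2"
    and smooth: "smooth_fn u"
    and supp: "compact (closure {x. u x \<noteq> 0})"
  shows "(LINT x|lborel. (lap_g psi u x)^2 * voldens psi x)
           - ((real CARD('n) - 1) / 2)^4 * (LINT x|lborel. (u x)^2 * voldens psi x)
         \<ge> (real CARD('n) - 4)^2 / 16 * (LINT x|lborel. (u x)^2 / (norm x)^4 * voldens psi x)
           + (real CARD('n) - 1)^2 / 16 * (LINT x|lborel. (u x)^2 / (norm x)^2 * voldens psi x)"
proof -
  \<comment> \<open>The radial curvature bound multiplied by -psi < 0 becomes psi'' >= psi, and
    psi(0) = 0 is the case k = 0 of the vanishing even derivatives.\<close>
  interpret model_profile psi D
  proof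
    show "psi 0 = 0" using even[rule_format, of 0] D0 by simp
    show "D 2 x \<ge> psi x" if "x > 0" for x
      using Krad[rule_format, OF that] pos[rule_format, OF that] by (simp add: field_simps)
  qed (use D0 Dder pos d1 in auto)
  have "bounded {x. u x \<noteq> 0}"
    using supp bounded_subset[OF compact_imp_bounded closure_subset] by blast
  then show ?thesis by (rule poincare_rellich[OF N5 smooth])
qed

end
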